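(* In single-key MagnifierSketch, for every value $v$ that is sent from the Candidate to the Representative, let $\hat w$ be the real quantile function at $v$ (with respect to the calibrated distribution $F'$). Then for any small positive number $\varepsilon$, $$\mathbb{P}(\hat w-0.5<-\varepsilon)=\mathbb{P}(\hat w-0.5>\varepsilon)\le e^{-\varepsilon^2 r}.$$
   Context: Let $w\in(0,1)$ be a fixed target quantile and $r,s$ positive even integers. Single-key MagnifierSketch processes a stream of real values and maintains two multisets, the Candidate $C$ (capacity $r$) and the Representative $R$ (capacity $s$), both initially empty. Basic insertion of an element $x$ (a real number or $\pm\infty$): add $x$ to $C$; if now $|C|=r$, let $v',v''$ be the $(r/2)$-th and $(r/2+1)$-th smallest elements of $C$, empty $C$, and add $v',v''$ to $R$ (these are the values "sent from the Candidate to the Representative"); if now $|R|>s$, remove one maximum and one minimum element of $R$. Distribution Calibration: when a stream value $v$ arrives, if $w>1/2$ draw $Z$ geometric on $\{1,2,\dots\}$ with success probability $1/(2w)$ and basic-insert $Z-1$ copies of $+\infty$ followed by $v$; if $w<1/2$ draw $Z$ geometric with success probability $1/(2-2w)$ and basic-insert $Z-1$ copies of $-\infty$ followed by $v$; if $w=1/2$ basic-insert $v$ only (independent draws). Standing assumption: stream values are i.i.d. with a continuous distribution function $F$. The calibrated distribution $F'$ is the distribution of an element basic-inserted into $C$: for $w>1/2$ it is $+\infty$ with probability $(2w-1)/(2w)$ and otherwise $F$-distributed; for $w<1/2$ it is $-\infty$ with probability $(1-2w)/(2-2w)$ and otherwise $F$-distributed. The quantile function with respect to $F'$ at an element $x$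 is: for $w\ge1/2$, $F(x)/(2w)$ if $x$ finite, and uniform on $[1/(2w),1]$ if $x=+\infty$ (ties among infinities broken uniformly at random); for $w<1/2$, $\frac{1-2w+F(x)}{2-2w}$ if $x$ finite, and uniform on $[0,\frac{1-2w}{2-2w}]$ if $x=-\infty$.
   Formalization: The equality of the two tails fails for v' or v'' taken separately (r=2: v' is a minimum of two uniforms), so it is stated for v chosen from the sent pair v', v'' by an independent fair coin; the bound is stated for both tails of each of v' and v''. *)

theory Defs
  imports "HOL-Probability.Probability" "HOL-Library.Multiset"
begin

text \<open>
  An element held by the sketch is an extended real together with a tag. The tag serves only to
  break ties: elements are compared by value first and by tag second. With independent tags
  uniform on the unit interval, ties among infinities are broken uniformly at random.
\<close>

datatype elem = Elem (el_val: ereal) (el_tag: real)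

instantiation elem :: linorder
begin

definition less_eq_elem :: "elem \<Rightarrow> elem \<Rightarrow> bool" where
  "x \<le> y \<longleftrightarrow> el_val x < el_val y \<or> (el_val x = el_val y \<and> el_tag x \<le> el_tag y)"

definition less_elem :: "elem \<Rightarrow> elem \<Rightarrow> bool" where
  "x < y \<longleftrightarrow> el_val x < el_val y \<or> (el_val x = el_val y \<and> el_tag x < el_tag y)"

instance
  by standard (auto simp: less_eq_elem_def less_elem_def intro: elem.expand)

end

text \<open>
  A state consists of the Candidate, the Representative, and a log recording, in chronological
  order, the pairs sent from the Candidate to the Representative. The log does not influence
  the run.
\<close>

type_synonym state = "elem multiset \<times> elem multiset \<times> (elem \<times> elem) list"

definition nth_smallest :: "'a::linorder multiset \<Rightarrow> nat \<Rightarrow> 'a" where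
  "nth_smallest A i = sorted_list_of_multiset A ! (i - 1)"

definition trim :: "nat \<Rightarrow> elem multiset \<Rightarrow> elem multiset" where
  "trim s R = (if size R > s then R - {# Max_mset R, Min_mset R #} else R)"

definition basic_insert :: "nat \<Rightarrow> nat \<Rightarrow> elem \<Rightarrow> state \<Rightarrow> state" where
  "basic_insert r s x = (\<lambda>(C, R, L).
     let C' = add_mset x C in
     if size C' = r then
       let v' = nth_smallest C' (r div 2);
           v'' = nth_smallest C' (r div 2 + 1)
       in ({#}, trim s (R + {# v', v'' #}), L @ [(v', v'')])
     else (C', R, L))"

definition geom_prob :: "real \<Rightarrow> real" where
  "geom_prob w = (if w > 1/2 then 1 / (2 * w) else 1 / (2 - 2 * w))"

definition calibrate :: "real \<Rightarrow> nat \<Rightarrow> real \<Rightarrow> ereal list" where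
  "calibrate w z v =
     (if w > 1/2 then replicate (z - 1) \<infinity> @ [ereal v]
      else if w < 1/2 then replicate (z - 1) (-\<infinity>) @ [ereal v]
      else [ereal v])"

text \<open>
  In what follows \<open>V\<close>, \<open>Z\<close> and \<open>U\<close> are realizations of the stream values and of the geometric
  draws (one of each per arrival) and of the tie-breaking tags (one per basic insertion).
\<close>

definition inserted_values :: "real \<Rightarrow> (nat \<Rightarrow> real) \<Rightarrow> (nat \<Rightarrow> nat) \<Rightarrow> nat \<Rightarrow> ereal list" where
  "inserted_values w V Z n = concat (map (\<lambda>i. calibrate w (Z i) (V i)) [0..<n])"

definition tag_elems :: "(nat \<Rightarrow> real) \<Rightarrow> ereal list \<Rightarrow> elem list" where
  "tag_elems U xs = map (\<lambda>i. Elem (xs ! i) (U i)) [0..<length xs]"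

definition sketch_state ::
  "nat \<Rightarrow> nat \<Rightarrow> real \<Rightarrow> (nat \<Rightarrow> real) \<Rightarrow> (nat \<Rightarrow> nat) \<Rightarrow> (nat \<Rightarrow> real) \<Rightarrow> nat \<Rightarrow> state" where
  "sketch_state r s w V Z U n =
     fold (basic_insert r s) (tag_elems U (inserted_values w V Z n)) ({#}, {#}, [])"

definition sent_log ::
  "nat \<Rightarrow> nat \<Rightarrow> real \<Rightarrow> (nat \<Rightarrow> real) \<Rightarrow> (nat \<Rightarrow> nat) \<Rightarrow> (nat \<Rightarrow> real) \<Rightarrow> nat \<Rightarrow> (elem \<times> elem) list" where
  "sent_log r s w V Z U n = snd (snd (sketch_state r s w V Z U n))"

text \<open>
  The \<open>k\<close>-th pair (counting from 0) sent in the run on the infinite stream, read off after the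
  first arrival by which it has been sent. The least number exists for \<open>r > 0\<close>, see
  \<open>sent_log_unbounded\<close> below.
\<close>

definition sent_pair ::
  "nat \<Rightarrow> nat \<Rightarrow> real \<Rightarrow> (nat \<Rightarrow> real) \<Rightarrow> (nat \<Rightarrow> nat) \<Rightarrow> (nat \<Rightarrow> real) \<Rightarrow> nat \<Rightarrow> elem \<times> elem" where
  "sent_pair r s w V Z U k =
     sent_log r s w V Z U (LEAST n. k < length (sent_log r s w V Z U n)) ! k"

text \<open>
  The quantile of an element with respect to the calibrated distribution. A tag uniform on the
  unit interval makes the quantile of \<open>\<infinity>\<close> uniform on \<open>[1/(2w), 1]\<close> for \<open>w > 1/2\<close>, and that of
  \<open>-\<infinity>\<close> uniform on \<open>[0, (1-2w)/(2-2w)]\<close> for \<open>w < 1/2\<close>, in agreement with the order on elements.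
  The values 0 and 1 are for infinities that are never inserted.
\<close>

definition quantile :: "real \<Rightarrow> (real \<Rightarrow> real) \<Rightarrow> elem \<Rightarrow> real" where
  "quantile w F x =
     (if w \<ge> 1/2 then
        (case el_val x of
           ereal v \<Rightarrow> F v / (2 * w)
         | PInfty \<Rightarrow> 1 / (2 * w) + el_tag x * (1 - 1 / (2 * w))
         | MInfty \<Rightarrow> 0)
      else
        (case el_val x of
           ereal v \<Rightarrow> (1 - 2 * w + F v) / (2 - 2 * w)
         | PInfty \<Rightarrow> 1
         | MInfty \<Rightarrow> el_tag x * ((1 - 2 * w) / (2 - 2 * w))))"

text \<open>
  Names for all elementary sources of randomness, so that their joint independence can be stated
  by a single family of real random variables. \<open>Coin k\<close> decides which element of the \<open>k\<close>-th
  sent pair is looked at; the sketch itself does not use it.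
\<close>

datatype source = Stream nat | Geom nat | Tag nat | Coin nat

primrec source_rv ::
  "(nat \<Rightarrow> 'a \<Rightarrow> real) \<Rightarrow> (nat \<Rightarrow> 'a \<Rightarrow> nat) \<Rightarrow> (nat \<Rightarrow> 'a \<Rightarrow> real) \<Rightarrow> (nat \<Rightarrow> 'a \<Rightarrow> bool)
    \<Rightarrow> source \<Rightarrow> 'a \<Rightarrow> real" where
  "source_rv V Z U B (Stream n) = V n"
| "source_rv V Z U B (Geom n) = (\<lambda>\<omega>. real (Z n \<omega>))"
| "source_rv V Z U B (Tag n) = U n"
| "source_rv V Z U B (Coin n) = (\<lambda>\<omega>. of_bool (B n \<omega>))"

lemma length_inserted_values: "n \<le> length (inserted_values w V Z n)"
proof (induction n)
  case (Suc n)
  have "length (calibrate w (Z n) (V n)) \<ge> 1" by (simp add: calibrate_def)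
  with Suc show ?case by (simp add: inserted_values_def)
qed simp

lemma fold_basic_insert_length:
  assumes "r > 0" and "size C < r"
  shows "case fold (basic_insert r s) xs (C, R, L) of (C', R', L') \<Rightarrow>
    size C' < r \<and> size C' + r * length L' = size C + r * length L + length xs"
  using assms(2)
proof (induction xs arbitrary: C R L)
  case (Cons x xs)
  show ?case
  proof (cases "Suc (size C) = r")
    case True
    then show ?thesis using assms(1) Cons.IH[where C = "{#}"]
      by (fastforce simp: basic_insert_def Let_def split: prod.splits)
  next
    case False
    then show ?thesis using Cons.IH[where C = "add_mset x C" and R = R and L = L] Cons.prems
      by (fastforce simp: basic_insert_def Let_def split: prod.splits)
  qed
qed simp

lemma sent_log_unbounded:
  assumes "r > 0"
  shows "\<exists>n. k < length (sent_log r s w V Z U n)"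
proof -
  define n where "n = (k + 1) * r"
  obtain C R L where st: "sketch_state r s w V Z U n = (C, R, L)"
    by (cases "sketch_state r s w V Z U n")
  have *: "size C < r" "size C + r * length L = length (inserted_values w V Z n)"
    using fold_basic_insert_length[where C = "{#}" and R = "{#}" and L = "[]" and r = r and s = s
        and xs = "tag_elems U (inserted_values w V Z n)"]
      assms st by (auto simp: sketch_state_def tag_elems_def)
  have "r * (k + 1) \<le> length (inserted_values w V Z n)"
    using length_inserted_values[of n w V Z] by (simp add: n_def mult.commute)
  then have "r * (k + 1) < r * (length L + 1)" using * unfolding distrib_left by linarith
  then have "k < length L" by (simp only: mult_less_cancel1) simp
  then show ?thesis using st by (auto simp: sent_log_def intro!: exI[of _ n])
qed

end

theory Submission
  imports Defs
begin

text \<open>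
  The calibrated quantiles of the inserted elements are i.i.d. uniform on the unit interval: an
  arrival that has already produced \<open>c\<close> paddings produces a further one with the same probability
  for every \<open>c\<close>, so the next inserted element always has the calibrated distribution,
  independently of the past. The \<open>k\<close>-th sent pair consists of the two middle elements of the
  \<open>k\<close>-th block of \<open>r\<close> insertions. Hence the quantile of a middle element exceeds \<open>1/2 + \<epsilon>\<close> iff
  at least \<open>r/2\<close> (or \<open>r/2 + 1\<close>) of \<open>r\<close> independent uniform variables do, and symmetrically below
  \<open>1/2 - \<epsilon>\<close>. With \<open>x = max 0 (1/2 - \<epsilon>)\<close>, such a binomial tail is at most
  \<open>2^r (x(1-x))^(r/2) \<le> exp (-2\<epsilon>\<^sup>2r)\<close>. The coin exchanges the two tails of the two
  middle elements, whence the equality.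
\<close>

section \<open>Order statistics as counts\<close>

text \<open>In the sorted list the positions satisfying \<open>P\<close> form an initial segment, so
  position \<open>i - 1\<close> belongs to it iff the segment has length at least \<open>i\<close>.
  Closure is required only among members of \<open>A\<close>, because quantile thresholds are
  compatible with the order only on elements whose tags lie in the unit interval.\<close>

lemma nth_smallest_iff:
  fixes A :: "'a::linorder multiset"
  assumes closed: "\<And>x y. x \<in># A \<Longrightarrow> y \<in># A \<Longrightarrow> x \<le> y \<Longrightarrow> P y \<Longrightarrow> P x"
    and i: "0 < i" "i \<le> size A"
  shows "P (nth_smallest A i) \<longleftrightarrow> i \<le> size (filter_mset P A)"
proof -
  define l where "l = sorted_list_of_multiset A"
  have l: "sorted l" "mset l = A" by (auto simp: l_def)
  have len: "length l = size A" using l by (metis size_mset)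
  have fl: "length (filter P l) = size (filter_mset P A)"
    using l by (metis mset_filter size_mset)
  have card: "length (filter P l) = card {j. j < length l \<and> P (l ! j)}"
    by (rule length_filter_conv_card)
  have mono: "P (l ! a)" if "a \<le> b" "b < length l" "P (l ! b)" for a b
  proof (rule closed)
    show "l ! a \<in># A" "l ! b \<in># A" using that unfolding l(2)[symmetric] by simp_all
    show "l ! a \<le> l ! b" using that l(1) by (simp add: sorted_iff_nth_mono)
  qed (use that in auto)
  have "P (l ! (i - 1)) \<longleftrightarrow> i \<le> card {j. j < length l \<and> P (l ! j)}"
  proof
    assume "P (l ! (i - 1))"
    then have "{..<i} \<subseteq> {j. j < length l \<and> P (l ! j)}"
      using mono[of _ "i - 1"] i len by auto
    from card_mono[OF _ this] show "i \<le> card {j. j < length l \<and> P (l ! j)}" by simp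
  next
    assume *: "i \<le> card {j. j < length l \<and> P (l ! j)}"
    show "P (l ! (i - 1))"
    proof (rule ccontr)
      assume "\<not> P (l ! (i - 1))"
      then have "{j. j < length l \<and> P (l ! j)} \<subseteq> {..<i - 1}"
        using mono[of "i - 1"] by (auto simp: not_less[symmetric])
      from card_mono[OF _ this] show False using * i by simp
    qed
  qed
  then show ?thesis using card fl by (simp add: nth_smallest_def l_def)
qed

lemma nth_smallest_in:
  assumes "0 < i" "i \<le> size A"
  shows "nth_smallest A i \<in># A"
proof -
  have "length (sorted_list_of_multiset A) = size A"
    by (metis mset_sorted_list_of_multiset size_mset)
  then have "nth_smallest A i \<in> set (sorted_list_of_multiset A)"
    unfolding nth_smallest_def using assms by (intro nth_mem) auto
  then show ?thesis by simp
qed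

section \<open>The log as a list of middle pairs of consecutive blocks\<close>

definition middle_pair :: "nat \<Rightarrow> elem list \<Rightarrow> elem \<times> elem" where
  "middle_pair r xs = (nth_smallest (mset xs) (r div 2), nth_smallest (mset xs) (r div 2 + 1))"

lemma basic_insert_mset:
  "\<exists>R'. basic_insert r s x (mset ys, R, L) =
     (if Suc (length ys) = r then ({#}, R', L @ [middle_pair r (ys @ [x])])
      else (mset (ys @ [x]), R', L))"
  by (simp add: basic_insert_def Let_def middle_pair_def)

text \<open>The Candidate is emptied after every \<open>r\<close> insertions, so the run cuts its
  input into blocks of length \<open>r\<close> and keeps the incomplete last block in the Candidate.
  Induction from the right fits this: a new element either extends that last block or completes
  it.\<close>

lemma fold_basic_insert_log:
  assumes "r > 0"
  shows "\<exists>R. fold (basic_insert r s) xs ({#}, {#}, []) =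
    (mset (drop (length xs div r * r) xs), R,
     map (\<lambda>k. middle_pair r (take r (drop (k * r) xs))) [0..<length xs div r])"
proof (induction xs rule: rev_induct)
  case (snoc x xs)
  define d where "d = length xs div r"
  have dle: "d * r \<le> length xs" by (simp add: d_def)
  \<comment> \<open>The first \<open>d\<close> blocks end inside \<open>xs\<close>, so the appended
    element does not reach them.\<close>
  have take_eq: "take r (drop (k * r) (xs @ [x])) = take r (drop (k * r) xs)" if "k < d" for k
  proof -
    have "Suc k * r \<le> d * r" using that by (intro mult_le_mono1) simp
    then have "k * r + r \<le> length xs" using dle by simp
    then show ?thesis by simp
  qed
  obtain R where R: "fold (basic_insert r s) xs ({#}, {#}, []) =
    (mset (drop (d * r) xs), R, map (\<lambda>k. middle_pair r (take r (drop (k * r) xs))) [0..<d])"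
    using snoc.IH by (auto simp: d_def)
  have drop_eq: "drop (d * r) (xs @ [x]) = drop (d * r) xs @ [x]" using dle by simp
  have maps: "map (\<lambda>k. middle_pair r (take r (drop (k * r) (xs @ [x])))) [0..<d]
      = map (\<lambda>k. middle_pair r (take r (drop (k * r) xs))) [0..<d]" (is "?L' = ?L")
    using take_eq by (intro map_cong refl) (simp_all del: drop_append take_append)
  obtain R' where step: "fold (basic_insert r s) (xs @ [x]) ({#}, {#}, []) =
      (if Suc (length (drop (d * r) xs)) = r
       then ({#}, R', ?L @ [middle_pair r (drop (d * r) xs @ [x])])
       else (mset (drop (d * r) xs @ [x]), R', ?L))"
    using basic_insert_mset[of r s x "drop (d * r) xs" R ?L] R by auto
  have len: "length (drop (d * r) xs) = length xs mod r"
    by (simp add: d_def minus_div_mult_eq_mod)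
  show ?case
  proof (cases "Suc (length xs mod r) = r")
    case True
    then have d': "length (xs @ [x]) div r = Suc d" by (simp add: div_Suc mod_Suc d_def)
    have e: "length (xs @ [x]) = Suc d * r"
      using True div_mult_mod_eq[of "length xs" r] unfolding d_def length_append_singleton mult_Suc
      by linarith
    then have "length (drop (d * r) (xs @ [x])) \<le> r" by (simp del: drop_append)
    then have t: "take r (drop (d * r) (xs @ [x])) = drop (d * r) xs @ [x]"
      by (metis drop_eq take_all)
    have "drop (Suc d * r) (xs @ [x]) = []" using e by (metis drop_all order_refl)
    moreover have "[0..<Suc d] = [0..<d] @ [d]" by simp
    ultimately show ?thesis
      unfolding d' step len using maps True t
      by (simp del: drop_append take_append)
  next
    case False
    then have d': "length (xs @ [x]) div r = d" by (simp add: div_Suc mod_Suc d_def)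
    show ?thesis
      unfolding d' step len maps drop_eq using False by simp
  qed
qed simp

section \<open>The sequence of inserted elements of the infinite run\<close>

text \<open>
  Which arrival the \<open>i\<close>-th element after the first \<open>c\<close> paddings of arrival \<open>n\<close> comes from, when
  arrival \<open>m\<close> contributes \<open>G m - 1\<close> paddings and then its value; \<open>None\<close> stands for a padding.
\<close>

fun slot :: "(nat \<Rightarrow> nat) \<Rightarrow> nat \<Rightarrow> nat \<Rightarrow> nat \<Rightarrow> nat option" where
  "slot G n c 0 = (if Suc c < G n then None else Some n)"
| "slot G n c (Suc i) = (if Suc c < G n then slot G n (Suc c) i else slot G (Suc n) 0 i)"

text \<open>The list is what remains to be inserted after \<open>c\<close> paddings of arrival
  \<open>n\<close>. Keeping \<open>n\<close> and \<open>c\<close> general lets the induction on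
  \<open>i\<close> drop the first element: this leads to \<open>Suc c\<close> after a padding and to
  arrival \<open>Suc n\<close> with no paddings after a value.\<close>

lemma slot_nth:
  fixes pad :: 'b
  assumes "c < G n" "\<And>m. 0 < G m"
    and "n < N"
    and "i < length (replicate (G n - 1 - c) pad @ [f n]
            @ concat (map (\<lambda>m. replicate (G m - 1) pad @ [f m]) [Suc n..<N]))"
  shows "(replicate (G n - 1 - c) pad @ [f n]
            @ concat (map (\<lambda>m. replicate (G m - 1) pad @ [f m]) [Suc n..<N])) ! i
         = (case slot G n c i of None \<Rightarrow> pad | Some m \<Rightarrow> f m)"
  using assms(1,3-)
proof (induction i arbitrary: n c)
  case 0
  then show ?case by (cases "G n - 1 - c") auto
next
  case (Suc i)
  show ?case
  proof (cases "Suc c < G n")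
    case True
    then have "G n - 1 - c = Suc (G n - 1 - Suc c)" by simp
    then show ?thesis using Suc.IH[of "Suc c" n] Suc.prems True by simp
  next
    case False
    then have e: "G n - 1 - c = 0" by simp
    show ?thesis
    proof (cases "Suc n < N")
      case True
      then have "[Suc n..<N] = Suc n # [Suc (Suc n)..<N]" by (rule upt_conv_Cons)
      then show ?thesis
        using Suc.IH[of 0 "Suc n"] Suc.prems False e True assms(2)[of "Suc n"] by simp
    next
      case F2: False
      with Suc.prems e show ?thesis by simp
    qed
  qed
qed

definition pad_value :: "real \<Rightarrow> ereal" where
  "pad_value w = (if w > 1/2 then \<infinity> else -\<infinity>)"

text \<open>
  The number of basic insertions that an arrival causes. A geometric draw of 0 counts as 1,
  because \<open>calibrate\<close> subtracts 1 from it on natural numbers.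
\<close>

definition block_size :: "real \<Rightarrow> nat \<Rightarrow> nat" where
  "block_size w z = (if w = 1/2 then 1 else max 1 z)"

lemma block_size_pos: "0 < block_size w z"
  by (simp add: block_size_def max_def)

text \<open>One form covers the three branches of \<open>calibrate\<close>: for
  \<open>w = 1/2\<close> the run of paddings is empty.\<close>

lemma calibrate_eq:
  "calibrate w z v = replicate (block_size w z - 1) (pad_value w) @ [ereal v]"
  by (auto simp: calibrate_def block_size_def pad_value_def max_def)

text \<open>The number of arrivals read so far is not a parameter, so a block of insertions can be
  described without saying which arrival completes it.\<close>

definition inserted_elem ::
  "real \<Rightarrow> (nat \<Rightarrow> real) \<Rightarrow> (nat \<Rightarrow> nat) \<Rightarrow> (nat \<Rightarrow> real) \<Rightarrow> nat \<Rightarrow> elem" where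
  "inserted_elem w V Z U i =
     (case slot (\<lambda>m. block_size w (Z m)) 0 0 i of
        None \<Rightarrow> Elem (pad_value w) (U i) | Some m \<Rightarrow> Elem (ereal (V m)) (U i))"

lemma tag_elems_inserted_values:
  "tag_elems U (inserted_values w V Z N)
     = map (inserted_elem w V Z U) [0..<length (inserted_values w V Z N)]"
proof (cases N)
  case 0
  then show ?thesis by (simp add: tag_elems_def inserted_values_def)
next
  case (Suc N')
  let ?G = "\<lambda>m. block_size w (Z m)"
  \<comment> \<open>Splitting off the first arrival gives the list the shape of
    \<open>slot_nth\<close> with \<open>n = 0\<close> and \<open>c = 0\<close>.\<close>
  have e: "inserted_values w V Z N = replicate (?G 0 - 1 - 0) (pad_value w) @ [ereal (V 0)]
      @ concat (map (\<lambda>m. replicate (?G m - 1) (pad_value w) @ [ereal (V m)]) [Suc 0..<N])"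
    unfolding inserted_values_def calibrate_eq using Suc by (simp add: upt_conv_Cons del: upt_Suc)
  have "inserted_values w V Z N ! i
      = (case slot ?G 0 0 i of None \<Rightarrow> pad_value w | Some m \<Rightarrow> ereal (V m))"
    if "i < length (inserted_values w V Z N)" for i
    unfolding e
    using that Suc unfolding e by (intro slot_nth) (simp_all add: block_size_pos)
  then show ?thesis
    by (auto simp: tag_elems_def inserted_elem_def split: option.split)
qed

text \<open>The log after any number of arrivals describes blocks of one fixed sequence, so the
  least \<open>n\<close> in \<open>sent_pair\<close> serves only to guarantee that block
  \<open>k\<close> is complete.\<close>

lemma sent_pair_eq:
  assumes "r > 0"
  shows "sent_pair r s w V Z U k
    = middle_pair r (map (inserted_elem w V Z U) [k * r..<k * r + r])"
proof -
  define n where "n = (LEAST n. k < length (sent_log r s w V Z U n))"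
  define L where "L = length (inserted_values w V Z n)"
  let ?xs = "map (inserted_elem w V Z U) [0..<L]"
  have log: "sent_log r s w V Z U n
      = map (\<lambda>k. middle_pair r (take r (drop (k * r) ?xs))) [0..<L div r]"
    using fold_basic_insert_log[OF assms, of s ?xs]
    by (auto simp: sent_log_def sketch_state_def tag_elems_inserted_values L_def)
  have "k < length (sent_log r s w V Z U n)"
    unfolding n_def by (rule LeastI_ex) (rule sent_log_unbounded[OF assms])
  then have k: "k < L div r" using log by simp
  then have "Suc k * r \<le> L div r * r" by (intro mult_le_mono1) simp
  also have "\<dots> \<le> L" by simp
  finally have "k * r + r \<le> L" by simp
  then have "take r (drop (k * r) ?xs) = map (inserted_elem w V Z U) [k * r..<k * r + r]"
    by (simp add: take_map drop_map)
  then show ?thesis using log k by (simp add: sent_pair_def n_def[symmetric])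
qed

section \<open>Monotonicity and measurability of quantiles, and geometric tails\<close>

lemma size_filter_mset_map_upt:
  "size (filter_mset P (mset (map f [a..<b]))) = card {i \<in> {a..<b}. P (f i)}"
proof -
  have "size (filter_mset P (mset (map f [a..<b]))) = length (filter (P \<circ> f) [a..<b])"
    by (metis mset_filter size_mset filter_map length_map)
  also have "\<dots> = card (set (filter (P \<circ> f) [a..<b]))"
    by (rule distinct_card[symmetric]) simp
  finally show ?thesis by (auto intro!: arg_cong[where f = card])
qed

lemma cdf_bounds:
  assumes "prob_space N" "cdf N = F" "sets N = sets borel"
  shows "0 \<le> F x" "F x \<le> 1" "mono F"
proof -
  interpret prob_space N by fact
  show "0 \<le> F x" "F x \<le> 1" using assms(2) by (auto simp: cdf_def)
  show "mono F" unfolding assms(2)[symmetric] cdf_def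
    by (intro monoI finite_measure_mono) (use assms(3) in auto)
qed

text \<open>The paddings and the finite values occupy adjacent intervals of quantiles:
  \<open>[p, 1]\<close> and \<open>[0, p]\<close> for \<open>w \<ge> 1/2\<close>,
  \<open>[0, a0]\<close> and \<open>[a0, 1]\<close> otherwise. The bounds on the tags keep each
  padding in its own interval, where the quantile increases with the tag.\<close>

lemma quantile_mono:
  assumes w: "0 < w" "w < 1" and F: "mono F" "\<And>x. 0 \<le> F x" "\<And>x. F x \<le> 1"
    and tags: "0 \<le> el_tag x" "el_tag x \<le> 1" "0 \<le> el_tag y" "el_tag y \<le> 1"
    and le: "x \<le> y"
  shows "quantile w F x \<le> quantile w F y"
proof -
  obtain a u b v where [simp]: "x = Elem a u" "y = Elem b v" by (metis elem.exhaust)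
  have ab: "a < b \<or> a = b \<and> u \<le> v" using le by (simp add: less_eq_elem_def)
  have uv: "0 \<le> u" "u \<le> 1" "0 \<le> v" "v \<le> 1" using tags by auto
  show ?thesis
  proof (cases "w \<ge> 1/2")
    case True
    define p where "p = 1 / (2 * w)"
    have p: "0 < p" "p \<le> 1" using True by (auto simp: p_def)
    have q: "quantile w F (Elem c t) = (case c of ereal v \<Rightarrow> p * F v
        | PInfty \<Rightarrow> p + t * (1 - p) | MInfty \<Rightarrow> 0)" for c t
      using True by (simp add: quantile_def p_def split: ereal.split)
    have m: "p * F c \<le> p * F d" if "c \<le> d" for c d
      using p F(1) that by (intro mult_left_mono) (auto dest: monoD)
    have n: "0 \<le> p * F c" "p * F c \<le> p" for c using F(2,3) p by (auto intro: mult_left_le)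
    have t: "0 \<le> t * (1 - p)" if "0 \<le> t" for t using that p by simp
    have t': "u * (1 - p) \<le> v * (1 - p)" if "u \<le> v" using that p by (intro mult_right_mono) auto
    have t2: "p * F c \<le> p + v * (1 - p)" for c using n(2)[of c] t[of v] uv by linarith
    have t3: "0 \<le> p + v * (1 - p)" using p t[of v] uv by linarith
    show ?thesis using ab p m n t2 t3 t'
      by (cases a; cases b) (auto simp: q)
  next
    case False
    define a0 where "a0 = (1 - 2 * w) / (2 - 2 * w)"
    have p: "0 \<le> a0" "a0 \<le> 1" using False w by (auto simp: a0_def)
    have "1 - a0 = 1 / (2 - 2 * w)" using w by (simp add: a0_def field_simps)
    then have e: "(1 - 2 * w + f) / (2 - 2 * w) = a0 + (1 - a0) * f" for f
      by (simp add: a0_def add_divide_distrib)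
    have q: "quantile w F (Elem c t) = (case c of ereal v \<Rightarrow> a0 + (1 - a0) * F v
        | PInfty \<Rightarrow> 1 | MInfty \<Rightarrow> t * a0)" for c t
      using False by (simp add: quantile_def e flip: a0_def split: ereal.split)
    have m: "(1 - a0) * F c \<le> (1 - a0) * F d" if "c \<le> d" for c d
      using p F(1) that by (intro mult_left_mono) (auto dest: monoD)
    have n: "0 \<le> (1 - a0) * F c" "(1 - a0) * F c \<le> 1 - a0" for c
      using F(2,3) p by (auto intro: mult_left_le)
    have n': "a0 + (1 - a0) * F c \<le> 1" for c using n(2)[of c] by linarith
    have t: "t * a0 \<le> a0" if "t \<le> 1" for t using that p by (metis mult.commute mult_left_le)
    have t2: "u * a0 \<le> a0 + (1 - a0) * F c" for c using t[of u] uv n(1)[of c] by linarith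
    have t3: "u * a0 \<le> 1" using t[of u] uv p by linarith
    have t': "u * a0 \<le> v * a0" if "u \<le> v" using that p by (intro mult_right_mono) auto
    show ?thesis using ab p m n' t2 t3 t'
      by (cases a; cases b) (auto simp: q)
  qed
qed

text \<open>The right side is a finite boolean combination of the conditions \<open>P j\<close>,
  which makes counting events measurable.\<close>

lemma le_card_filter_iff:
  assumes "finite K"
  shows "m \<le> card {j \<in> K. P j} \<longleftrightarrow> (\<exists>J\<in>Pow K. m \<le> card J \<and> (\<forall>j\<in>J. P j))"
proof
  assume "m \<le> card {j \<in> K. P j}"
  then show "\<exists>J\<in>Pow K. m \<le> card J \<and> (\<forall>j\<in>J. P j)"
    by (intro bexI[of _ "{j \<in> K. P j}"]) auto
next
  assume "\<exists>J\<in>Pow K. m \<le> card J \<and> (\<forall>j\<in>J. P j)"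
  then obtain J where J: "J \<subseteq> K" "m \<le> card J" "\<forall>j\<in>J. P j" by auto
  then have "card J \<le> card {j \<in> K. P j}" using assms by (intro card_mono) auto
  with J show "m \<le> card {j \<in> K. P j}" by simp
qed

lemma geom_prob_bounds:
  assumes "0 < w" "w < 1"
  shows "0 < geom_prob w" "geom_prob w \<le> 1"
  using assms by (auto simp: geom_prob_def)

text \<open>\<open>geometric_pmf\<close> counts failures and \<open>Suc\<close> adds the final
  success, so exceeding \<open>c\<close> means that the first \<open>c\<close> trials fail. The
  induction splits off one atom at a time.\<close>

lemma geometric_tail:
  assumes "0 < p" "p \<le> 1"
  shows "measure_pmf.prob (map_pmf Suc (geometric_pmf p)) {c<..} = (1 - p) ^ c"
proof (induction c)
  case 0
  have "Suc -` {0<..} = UNIV" by auto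
  then show ?case by simp
next
  case (Suc c)
  have "Suc -` {c<..} = insert c (Suc -` {Suc c<..})" by auto
  then have "measure_pmf.prob (geometric_pmf p) (Suc -` {c<..})
     = measure_pmf.prob (geometric_pmf p) {c} + measure_pmf.prob (geometric_pmf p) (Suc -` {Suc c<..})"
    by (subst measure_pmf.finite_measure_Union[symmetric]) auto
  then show ?case using Suc assms by (simp add: measure_pmf_single algebra_simps)
qed

definition pad_quantile :: "real \<Rightarrow> (real \<Rightarrow> real) \<Rightarrow> real \<Rightarrow> real" where
  "pad_quantile w F u = quantile w F (Elem (pad_value w) u)"

text \<open>The tag 0 is a placeholder: the quantile of a finite element is a function of the stream
  value alone, see \<open>quantile_Elem_ereal\<close>.\<close>

definition value_quantile :: "real \<Rightarrow> (real \<Rightarrow> real) \<Rightarrow> real \<Rightarrow> real" where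
  "value_quantile w F v = quantile w F (Elem (ereal v) 0)"

lemma pad_quantile_measurable [measurable]: "pad_quantile w F \<in> borel_measurable borel"
  by (cases "w > 1/2"; cases "w < 1/2")
    (simp_all add: pad_quantile_def[abs_def] quantile_def pad_value_def)

lemma quantile_Elem_ereal: "quantile w F (Elem (ereal v) u) = value_quantile w F v"
  by (simp add: value_quantile_def quantile_def)

lemma value_quantile_measurable [measurable]:
  assumes [measurable]: "F \<in> borel_measurable borel"
  shows "value_quantile w F \<in> borel_measurable borel"
  by (cases "w \<ge> 1/2") (simp_all add: value_quantile_def[abs_def] quantile_def)

section \<open>The random sources and the law of a single quantile\<close>

locale calibrated_stream = prob_space M for M :: "'a measure" +
  fixes V :: "nat \<Rightarrow> 'a \<Rightarrow> real" and Z :: "nat \<Rightarrow> 'a \<Rightarrow> nat"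
    and U :: "nat \<Rightarrow> 'a \<Rightarrow> real" and B :: "nat \<Rightarrow> 'a \<Rightarrow> bool"
    and F :: "real \<Rightarrow> real" and w :: real
  assumes w: "0 < w" "w < 1"
    and indep: "indep_vars (\<lambda>_. borel) (source_rv V Z U B) UNIV"
    and stream: "\<And>n. cdf (distr M borel (V n)) = F"
    and F: "continuous_on UNIV F"
    and geom: "\<And>n. distr M (count_space UNIV) (Z n)
                     = measure_pmf (map_pmf Suc (geometric_pmf (geom_prob w)))"
    and tags: "\<And>n. distr M borel (U n) = uniform_measure lborel {0..1}"
    and coins: "\<And>n. distr M (count_space UNIV) (B n) = measure_pmf (bernoulli_pmf (1/2))"
begin

abbreviation X :: "source \<Rightarrow> 'a \<Rightarrow> real" where "X \<equiv> source_rv V Z U B"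

lemma X_measurable: "X i \<in> borel_measurable M"
  using indep by (auto simp: indep_vars_def)

lemma V_measurable [measurable]: "V n \<in> borel_measurable M"
  using X_measurable[of "Stream n"] by simp

lemma U_measurable [measurable]: "U n \<in> borel_measurable M"
  using X_measurable[of "Tag n"] by simp

text \<open>Independence is stated for real variables, so \<open>Z n\<close> has to be recovered
  from its real image.\<close>

lemma Z_measurable [measurable]: "Z n \<in> measurable M (count_space UNIV)"
proof -
  have [measurable]: "(\<lambda>\<omega>. real (Z n \<omega>)) \<in> borel_measurable M"
    using X_measurable[of "Geom n"] by simp
  have "(\<lambda>\<omega>. nat \<lfloor>real (Z n \<omega>)\<rfloor>) \<in> measurable M (count_space UNIV)" by measurable
  then show ?thesis by simp
qed

lemma B_measurable [measurable]: "B n \<in> measurable M (count_space UNIV)"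
proof -
  have [measurable]: "(\<lambda>\<omega>. of_bool (B n \<omega>) :: real) \<in> borel_measurable M"
    using X_measurable[of "Coin n"] by simp
  have "(\<lambda>\<omega>. (of_bool (B n \<omega>) :: real) = 1) \<in> measurable M (count_space UNIV)" by measurable
  then show ?thesis by simp
qed

lemma F_measurable [measurable]: "F \<in> borel_measurable borel"
  using F by (rule borel_measurable_continuous_onI)

definition G :: "'a \<Rightarrow> nat \<Rightarrow> nat" where "G \<omega> n = block_size w (Z n \<omega>)"

lemma G_pos: "0 < G \<omega> n" by (simp add: G_def block_size_pos)

lemma G_measurable [measurable]: "(\<lambda>\<omega>. G \<omega> n) \<in> measurable M (count_space UNIV)"
  unfolding G_def by measurable

text \<open>For \<open>w = 1/2\<close> a block has size 1 while \<open>geom_prob w = 1\<close>, so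
  both sides agree as \<open>0 ^ c\<close>. Otherwise, for \<open>c > 0\<close>, counting a draw of
  0 as 1 does not change the event, and the geometric tail applies.\<close>

lemma prob_G: "prob {\<omega> \<in> space M. c < G \<omega> n} = (1 - geom_prob w) ^ c"
proof (cases "c = 0 \<or> w = 1/2")
  case True
  show ?thesis
  proof (cases "c = 0")
    case True
    then show ?thesis using prob_space by (simp add: G_pos)
  next
    case False
    with True have "w = 1/2" by simp
    with False show ?thesis by (simp add: G_def block_size_def geom_prob_def)
  qed
next
  case False
  then have "{\<omega> \<in> space M. c < G \<omega> n} = Z n -` {c<..} \<inter> space M"
    by (auto simp: G_def block_size_def)
  then have "prob {\<omega> \<in> space M. c < G \<omega> n} = measure (distr M (count_space UNIV) (Z n)) {c<..}"
    by (simp add: measure_distr)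
  then show ?thesis using geometric_tail[OF geom_prob_bounds[OF w], of c] by (simp only: geom)
qed

lemma prob_G_eq:
  "prob {\<omega> \<in> space M. G \<omega> n = Suc c} = geom_prob w * (1 - geom_prob w) ^ c"
proof -
  have "{\<omega> \<in> space M. G \<omega> n = Suc c} = {\<omega> \<in> space M. c < G \<omega> n} - {\<omega> \<in> space M. Suc c < G \<omega> n}"
    by auto
  also have "prob \<dots> = prob {\<omega> \<in> space M. c < G \<omega> n} - prob {\<omega> \<in> space M. Suc c < G \<omega> n}"
    by (intro finite_measure_Diff) auto
  finally show ?thesis by (simp add: prob_G algebra_simps)
qed

lemma prob_sources:
  assumes "finite I" "\<And>i. D i \<in> sets borel"
  shows "prob {\<omega> \<in> space M. \<forall>i\<in>I. X i \<omega> \<in> D i} = (\<Prod>i\<in>I. prob {\<omega> \<in> space M. X i \<omega> \<in> D i})"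
proof (cases "I = {}")
  case False
  have e: "X i -` D i \<inter> space M = {\<omega> \<in> space M. X i \<omega> \<in> D i}" for i by auto
  have "prob (\<Inter>i\<in>I. X i -` D i \<inter> space M) = (\<Prod>i\<in>I. prob (X i -` D i \<inter> space M))"
    using indep_varsD[OF indep False assms(1)] assms(2) by blast
  moreover have "{\<omega> \<in> space M. \<forall>i\<in>I. X i \<omega> \<in> D i} = (\<Inter>i\<in>I. X i -` D i \<inter> space M)"
    using False by auto
  ultimately show ?thesis by (simp only: e)
qed (simp add: prob_space)

text \<open>Here \<open>j\<close> counts the insertions already made, so the \<open>i\<close>-th
  element from now on carries tag \<open>j + i\<close>.\<close>

definition slot_quantile :: "nat \<Rightarrow> nat \<Rightarrow> nat \<Rightarrow> nat \<Rightarrow> 'a \<Rightarrow> real" where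
  "slot_quantile n c j i \<omega> =
     (case slot (G \<omega>) n c i of
        None \<Rightarrow> pad_quantile w F (U (j + i) \<omega>) | Some m \<Rightarrow> value_quantile w F (V m \<omega>))"

lemma slot_measurable [measurable]: "(\<lambda>\<omega>. slot (G \<omega>) n c i) \<in> measurable M (count_space UNIV)"
  by (induction i arbitrary: n c) simp_all

lemma slot_case_measurable:
  assumes "f \<in> measurable M N" "\<And>m. g m \<in> measurable M N"
  shows "(\<lambda>\<omega>. case slot (G \<omega>) n c i of None \<Rightarrow> f \<omega> | Some m \<Rightarrow> g m \<omega>) \<in> measurable M N"
proof (rule measurable_compose_countable[OF _ slot_measurable])
  show "(\<lambda>\<omega>. case a of None \<Rightarrow> f \<omega> | Some m \<Rightarrow> g m \<omega>) \<in> measurable M N" for a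
    using assms by (cases a) simp_all
qed

lemma slot_quantile_measurable [measurable]: "slot_quantile n c j i \<in> borel_measurable M"
  unfolding slot_quantile_def[abs_def] by (rule slot_case_measurable) measurable

definition pad_prob :: "real set \<Rightarrow> real" where
  "pad_prob S = prob {\<omega> \<in> space M. pad_quantile w F (U 0 \<omega>) \<in> S}"

definition value_prob :: "real set \<Rightarrow> real" where
  "value_prob S = prob {\<omega> \<in> space M. value_quantile w F (V 0 \<omega>) \<in> S}"

text \<open>The law of the quantile of an element drawn from the calibrated distribution:
  \<open>1 - geom_prob w\<close> is the mass that this distribution gives to the infinity.\<close>

definition calibrated_prob :: "real set \<Rightarrow> real" where
  "calibrated_prob S = (1 - geom_prob w) * pad_prob S + geom_prob w * value_prob S"

lemma prob_cong_distr:
  assumes [measurable]: "f \<in> borel_measurable M" "g \<in> borel_measurable M" "h \<in> borel_measurable borel"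
    "S \<in> sets borel" and eq: "distr M borel f = distr M borel g"
  shows "prob {\<omega> \<in> space M. h (f \<omega>) \<in> S} = prob {\<omega> \<in> space M. h (g \<omega>) \<in> (S :: real set)}"
proof -
  have "prob {\<omega> \<in> space M. h (k \<omega>) \<in> S} = measure (distr M borel k) (h -` S \<inter> space borel)"
    if [measurable]: "k \<in> borel_measurable M" for k
    using measurable_sets_borel[OF assms(3,4)]
    by (subst measure_distr) (auto intro!: arg_cong[where f = prob])
  then show ?thesis using eq by simp
qed

lemma distr_V: "distr M borel (V n) = distr M borel (V 0)"
  by (rule cdf_unique) (auto simp: stream real_distribution_distr)

lemma pad_prob_eq:
  "S \<in> sets borel \<Longrightarrow> prob {\<omega> \<in> space M. pad_quantile w F (U n \<omega>) \<in> S} = pad_prob S"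
  unfolding pad_prob_def by (rule prob_cong_distr) (auto simp: tags)

lemma value_prob_eq:
  "S \<in> sets borel \<Longrightarrow> prob {\<omega> \<in> space M. value_quantile w F (V n \<omega>) \<in> S} = value_prob S"
  unfolding value_prob_def by (rule prob_cong_distr) (auto intro: distr_V)

lemma calibrated_prob_UNIV: "calibrated_prob UNIV = 1"
  by (simp add: calibrated_prob_def pad_prob_def value_prob_def prob_space)

lemma calibrated_prob_Compl:
  assumes [measurable]: "S \<in> sets borel"
  shows "calibrated_prob (- S) = 1 - calibrated_prob S"
proof -
  have "pad_prob (- S) = 1 - pad_prob S" unfolding pad_prob_def
    by (subst prob_compl[symmetric]) (auto intro!: arg_cong[where f = prob])
  moreover have "value_prob (- S) = 1 - value_prob S" unfolding value_prob_def
    by (subst prob_compl[symmetric]) (auto intro!: arg_cong[where f = prob])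
  ultimately show ?thesis
    unfolding calibrated_prob_def by (simp only:) (simp add: algebra_simps)
qed

section \<open>Independence of the successive quantiles\<close>

text \<open>
  The run is observed after \<open>c\<close> paddings of arrival \<open>n\<close> and \<open>j\<close> basic insertions. The sources in
  \<open>I\<close> are those already consumed; constraining them arbitrarily makes the law of the next \<open>N\<close>
  quantiles provable by induction on \<open>N\<close>.
\<close>

definition source_event ::
  "source set \<Rightarrow> (source \<Rightarrow> real set) \<Rightarrow> nat \<Rightarrow> nat \<Rightarrow> nat \<Rightarrow> nat \<Rightarrow> (nat \<Rightarrow> real set) \<Rightarrow> 'a set" where
  "source_event I D n c j N A = {\<omega> \<in> space M. (\<forall>i\<in>I. X i \<omega> \<in> D i) \<and> c < G \<omega> n
     \<and> (\<forall>i<N. slot_quantile n c j i \<omega> \<in> A i)}"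

lemma source_event_measurable:
  assumes "finite I" and [measurable]: "\<And>i. D i \<in> sets borel" "\<And>i. A i \<in> sets borel"
  shows "source_event I D n c j N A \<in> sets M"
proof -
  note X_measurable [measurable]
  have [measurable]: "Measurable.pred M (\<lambda>\<omega>. \<forall>i\<in>I. X i \<omega> \<in> D i)"
    using assms(1) by (intro pred_intros_finite) auto
  show ?thesis unfolding source_event_def by measurable
qed

text \<open>The next element is either a padding, which consumes \<open>Tag j\<close> and raises
  \<open>c\<close>, or the value of arrival \<open>n\<close>, which consumes \<open>Stream n\<close>
  and reveals the size of the block through \<open>Geom n\<close>. Freshness of these sources
  ensures that updating \<open>D\<close> overwrites no earlier constraint.\<close>

lemma source_event_Suc:
  assumes I: "Tag j \<notin> I" "Stream n \<notin> I" "Geom n \<notin> I"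
  shows "source_event I D n c j (Suc N) A =
     source_event (insert (Tag j) I) (D(Tag j := pad_quantile w F -` A 0))
       n (Suc c) (Suc j) N (\<lambda>i. A (Suc i))
   \<union> source_event (insert (Stream n) (insert (Geom n) I))
       (D(Stream n := value_quantile w F -` A 0, Geom n := {x. block_size w (nat \<lfloor>x\<rfloor>) = Suc c}))
       (Suc n) 0 (Suc j) N (\<lambda>i. A (Suc i))" (is "?E = ?E1 \<union> ?E2")
proof (rule set_eqI)
  fix \<omega>
  have D1: "(\<forall>i\<in>insert (Tag j) I. X i \<omega> \<in> (D(Tag j := pad_quantile w F -` A 0)) i)
      \<longleftrightarrow> pad_quantile w F (U j \<omega>) \<in> A 0 \<and> (\<forall>i\<in>I. X i \<omega> \<in> D i)"
    using I by auto
  have D2: "(\<forall>i\<in>insert (Stream n) (insert (Geom n) I). X i \<omega> \<in> (D(Stream n := value_quantile w F -` A 0,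
        Geom n := {x. block_size w (nat \<lfloor>x\<rfloor>) = Suc c})) i)
      \<longleftrightarrow> value_quantile w F (V n \<omega>) \<in> A 0 \<and> G \<omega> n = Suc c \<and> (\<forall>i\<in>I. X i \<omega> \<in> D i)"
    using I by (auto simp: G_def)
  show "\<omega> \<in> ?E \<longleftrightarrow> \<omega> \<in> ?E1 \<union> ?E2"
  proof (cases "Suc c < G \<omega> n")
    case True
    then show ?thesis
      by (simp only: source_event_def D1 D2 Un_iff mem_Collect_eq All_less_Suc2)
        (auto simp: slot_quantile_def cong: option.case_cong)
  next
    case False
    then have "c < G \<omega> n \<longleftrightarrow> G \<omega> n = Suc c" by auto
    with False show ?thesis
      by (simp only: source_event_def D1 D2 Un_iff mem_Collect_eq All_less_Suc2)
        (auto simp: slot_quantile_def G_pos cong: option.case_cong)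
  qed
qed

text \<open>Memorylessness: beyond the common factor, the two continuations contribute
  \<open>(1 - geom_prob w) * pad_prob (A 0)\<close> and
  \<open>geom_prob w * value_prob (A 0)\<close> for every \<open>c\<close>, and these add up to
  \<open>calibrated_prob (A 0)\<close>.\<close>

lemma prob_source_event:
  assumes "finite I" "\<And>i. D i \<in> sets borel" "\<And>i. A i \<in> sets borel"
    and "\<And>m. n \<le> m \<Longrightarrow> Stream m \<notin> I \<and> Geom m \<notin> I" "\<And>m. j \<le> m \<Longrightarrow> Tag m \<notin> I"
  shows "prob (source_event I D n c j N A)
    = (\<Prod>i\<in>I. prob {\<omega> \<in> space M. X i \<omega> \<in> D i}) * (1 - geom_prob w) ^ c
      * (\<Prod>i<N. calibrated_prob (A i))"
  using assms
proof (induction N arbitrary: I D n c j A)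
  case 0
  \<comment> \<open>With no quantile left to observe, \<open>c < G \<omega> n\<close> becomes one
    more constraint on an independent source.\<close>
  let ?D = "D(Geom n := {x. c < block_size w (nat \<lfloor>x\<rfloor>)})"
  have notin: "Geom n \<notin> I" using 0 by auto
  have "source_event I D n c j 0 A = {\<omega> \<in> space M. \<forall>i\<in>insert (Geom n) I. X i \<omega> \<in> ?D i}"
    using notin by (auto simp: source_event_def G_def)
  also have "prob \<dots> = (\<Prod>i\<in>insert (Geom n) I. prob {\<omega> \<in> space M. X i \<omega> \<in> ?D i})"
    using 0 by (intro prob_sources) auto
  also have "\<dots> = prob {\<omega> \<in> space M. c < G \<omega> n} * (\<Prod>i\<in>I. prob {\<omega> \<in> space M. X i \<omega> \<in> D i})"
    using notin 0(1) by (subst prod.insert) (auto simp: G_def intro!: arg_cong2[where f = times] prod.cong)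
  finally show ?case by (simp add: prob_G)
next
  case (Suc N)
  note [measurable] = Suc.prems(2,3)
  define D1 where "D1 = D(Tag j := pad_quantile w F -` A 0)"
  define D2 where "D2 = D(Stream n := value_quantile w F -` A 0,
      Geom n := {x. block_size w (nat \<lfloor>x\<rfloor>) = Suc c})"
  have m1: "pad_quantile w F -` A 0 \<in> sets borel"
    using measurable_sets[OF pad_quantile_measurable, of "A 0"] Suc.prems(3) by simp
  have m2: "value_quantile w F -` A 0 \<in> sets borel"
    using measurable_sets[OF value_quantile_measurable, of F "A 0"] Suc.prems(3) by simp
  have m3: "{x::real. block_size w (nat \<lfloor>x\<rfloor>) = Suc c} \<in> sets borel" by measurable
  have D1m: "D1 i \<in> sets borel" and D2m: "D2 i \<in> sets borel" for i
    using m1 m2 m3 Suc.prems(2) by (auto simp: D1_def D2_def)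
  have I: "Tag j \<notin> I" "Stream n \<notin> I" "Geom n \<notin> I" using Suc.prems by auto
  let ?P = "\<Prod>i\<in>I. prob {\<omega> \<in> space M. X i \<omega> \<in> D i}"
  let ?Q = "\<Prod>i<N. calibrated_prob (A (Suc i))"
  let ?E1 = "source_event (insert (Tag j) I) D1 n (Suc c) (Suc j) N (\<lambda>i. A (Suc i))"
  let ?E2 = "source_event (insert (Stream n) (insert (Geom n) I)) D2 (Suc n) 0 (Suc j) N (\<lambda>i. A (Suc i))"
  have "prob ?E1 = (\<Prod>i\<in>insert (Tag j) I. prob {\<omega> \<in> space M. X i \<omega> \<in> D1 i})
      * (1 - geom_prob w) ^ Suc c * ?Q"
    using Suc.prems D1m by (intro Suc.IH) (auto simp: Suc_le_eq)
  moreover have "(\<Prod>i\<in>insert (Tag j) I. prob {\<omega> \<in> space M. X i \<omega> \<in> D1 i}) = pad_prob (A 0) * ?P"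
    using I Suc.prems by (auto simp: D1_def pad_prob_eq intro!: prod.cong)
  ultimately have E1: "prob ?E1 = pad_prob (A 0) * ?P * (1 - geom_prob w) ^ Suc c * ?Q" by simp
  have "prob ?E2 = (\<Prod>i\<in>insert (Stream n) (insert (Geom n) I). prob {\<omega> \<in> space M. X i \<omega> \<in> D2 i})
      * (1 - geom_prob w) ^ 0 * ?Q"
    using Suc.prems D2m by (intro Suc.IH) (auto simp: Suc_le_eq)
  moreover have "(\<Prod>i\<in>insert (Stream n) (insert (Geom n) I). prob {\<omega> \<in> space M. X i \<omega> \<in> D2 i})
      = value_prob (A 0) * prob {\<omega> \<in> space M. G \<omega> n = Suc c} * ?P"
    using I Suc.prems by (auto simp: D2_def value_prob_eq G_def intro!: prod.cong)
  ultimately have E2: "prob ?E2 = value_prob (A 0) * (geom_prob w * (1 - geom_prob w) ^ c) * ?P * ?Q"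
    by (simp add: prob_G_eq)
  \<comment> \<open>The first event requires \<open>Suc c < G \<omega> n\<close>, the second
    \<open>G \<omega> n = Suc c\<close>.\<close>
  have disj: "?E1 \<inter> ?E2 = {}"
    using I by (auto simp: source_event_def D2_def G_def)
  have "prob (source_event I D n c j (Suc N) A) = prob ?E1 + prob ?E2"
    unfolding source_event_Suc[OF I] D1_def[symmetric] D2_def[symmetric]
    using Suc.prems D1m D2m disj by (intro finite_measure_Union source_event_measurable) auto
  also have "\<dots> = ?P * (1 - geom_prob w) ^ c * (calibrated_prob (A 0) * ?Q)"
    unfolding E1 E2 calibrated_prob_def by (simp add: algebra_simps)
  finally show ?case by (simp add: prod.lessThan_Suc_shift del: prod.lessThan_Suc)
qed

end

section \<open>An exponential bound for binomial tails\<close>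

text \<open>The probability of at least \<open>m\<close> successes in \<open>card K\<close>
  independent trials. The sum runs over the sets \<open>J\<close> of successful trials, matching the
  decomposition of events in \<open>prob_block_count\<close>.\<close>

definition binomial_tail :: "'b set \<Rightarrow> real \<Rightarrow> nat \<Rightarrow> real" where
  "binomial_tail K x m = (\<Sum>J | J \<subseteq> K \<and> m \<le> card J. x ^ card J * (1 - x) ^ (card K - card J))"

text \<open>If \<open>J\<close> exceeds half of the trials by \<open>d\<close>, replacing
  \<open>d\<close> factors \<open>x\<close> by the larger \<open>1 - x\<close> bounds its summand by
  \<open>(x * (1 - x)) ^ h\<close>. There are at most \<open>4 ^ h\<close> summands.\<close>

lemma binomial_tail_bound:
  assumes x: "0 \<le> x" "x \<le> 1/2" and m: "h \<le> m" and K: "finite K" "card K = 2 * h"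
  shows "binomial_tail K x m \<le> (4 * (x * (1 - x))) ^ h"
proof -
  have "x ^ card J * (1 - x) ^ (card K - card J) \<le> (x * (1 - x)) ^ h"
    if "J \<subseteq> K" "m \<le> card J" for J
  proof -
    have "card J \<le> card K" using card_mono[OF K(1) that(1)] .
    define d where "d = card J - h"
    have d: "card J = h + d" "h = (card K - card J) + d"
      using that(2) m K(2) \<open>card J \<le> card K\<close> by (auto simp: d_def)
    have "x ^ card J * (1 - x) ^ (card K - card J) = x ^ h * (x ^ d * (1 - x) ^ (card K - card J))"
      by (simp add: d(1) power_add)
    also have "\<dots> \<le> x ^ h * ((1 - x) ^ d * (1 - x) ^ (card K - card J))"
      using x by (intro mult_left_mono mult_right_mono power_mono) auto
    also have "\<dots> = x ^ h * (1 - x) ^ h"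
      by (metis d(2) power_add mult.commute)
    finally show ?thesis by (simp add: power_mult_distrib)
  qed
  then have "binomial_tail K x m
      \<le> (\<Sum>J | J \<subseteq> K \<and> m \<le> card J. (x * (1 - x)) ^ h)"
    unfolding binomial_tail_def by (intro sum_mono) auto
  also have "\<dots> = card {J. J \<subseteq> K \<and> m \<le> card J} * (x * (1 - x)) ^ h" by simp
  also have "\<dots> \<le> 4 ^ h * (x * (1 - x)) ^ h"
  proof (rule mult_right_mono)
    have "card {J. J \<subseteq> K \<and> m \<le> card J} \<le> card (Pow K)"
      using K(1) by (intro card_mono) auto
    also have "\<dots> = 4 ^ h" by (simp add: card_Pow K power_mult)
    finally have "real (card {J. J \<subseteq> K \<and> m \<le> card J}) \<le> real (4 ^ h)"
      by (simp only: of_nat_le_iff)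
    then show "real (card {J. J \<subseteq> K \<and> m \<le> card J}) \<le> 4 ^ h" by simp
  qed (use x in simp)
  also have "\<dots> = (4 * (x * (1 - x))) ^ h" by (simp add: power_mult_distrib)
  finally show ?thesis .
qed

text \<open>For \<epsilon> at most 1/2 the base \<open>4 * (x * (1 - x))\<close> equals
  \<open>1 - 4 * \<epsilon>\<^sup>2\<close>, hence is at most
  \<open>exp (- (2 * \<epsilon>\<^sup>2))\<close>; the exponent \<open>h\<close> is half of
  \<open>card K\<close>. For larger \<epsilon> the base is 0.\<close>

lemma binomial_tail_le_exp:
  assumes "\<epsilon> > 0" and m: "h \<le> m" and K: "finite K" "card K = 2 * h" and h: "0 < h"
  shows "binomial_tail K (max 0 (1/2 - \<epsilon>)) m \<le> exp (- (\<epsilon>\<^sup>2 * real (card K)))"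
proof -
  let ?x = "max 0 (1/2 - \<epsilon>)"
  have "binomial_tail K ?x m \<le> (4 * (?x * (1 - ?x))) ^ h"
    using assms by (intro binomial_tail_bound) (auto simp: max_def)
  also have "\<dots> \<le> exp (- (2 * \<epsilon>\<^sup>2)) ^ h"
  proof (rule power_mono)
    show "0 \<le> 4 * (?x * (1 - ?x))" using assms by (auto simp: max_def)
    show "4 * (?x * (1 - ?x)) \<le> exp (- (2 * \<epsilon>\<^sup>2))"
    proof (cases "\<epsilon> \<le> 1/2")
      case True
      then have "4 * (?x * (1 - ?x)) = 1 - 4 * \<epsilon>\<^sup>2"
        by (simp add: max_def power2_eq_square field_simps)
      also have "\<dots> \<le> 1 + - (2 * \<epsilon>\<^sup>2)" by simp
      also have "\<dots> \<le> exp (- (2 * \<epsilon>\<^sup>2))" by (rule exp_ge_add_one_self)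
      finally show ?thesis .
    next
      case False
      then show ?thesis by simp
    qed
  qed
  also have "\<dots> = exp (- (\<epsilon>\<^sup>2 * real (card K)))"
    by (simp add: K exp_of_nat_mult[symmetric] algebra_simps)
  finally show ?thesis .
qed

text \<open>The distribution function of the uniform law on the unit interval.\<close>

definition clamp01 :: "real \<Rightarrow> real" where "clamp01 x = max 0 (min 1 x)"

text \<open>Clears the division from a weighted, rescaled uniform distribution function, so that the
  two parts of the mixture can be added by case distinction.\<close>

lemma mult_clamp01: "0 < c \<Longrightarrow> c * clamp01 (y / c) = max 0 (min c y)"
  by (auto simp: clamp01_def max_def min_def field_simps)

section \<open>Uniformity of the calibrated quantile\<close>

context calibrated_stream
begin

lemma U_prob: "S \<in> sets borel \<Longrightarrow> prob {\<omega> \<in> space M. U n \<omega> \<in> S} = measure lborel ({0..1} \<inter> S)"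
proof -
  assume [measurable]: "S \<in> sets borel"
  have "prob {\<omega> \<in> space M. U n \<omega> \<in> S} = measure (distr M borel (U n)) S"
    by (subst measure_distr) (auto intro!: arg_cong[where f = prob])
  also have "\<dots> = measure lborel ({0..1} \<inter> S)"
    unfolding tags by (subst measure_uniform_measure) auto
  finally show ?thesis .
qed

lemma U_less: "prob {\<omega> \<in> space M. U n \<omega> < x} = clamp01 x"
proof -
  have "prob {\<omega> \<in> space M. U n \<omega> < x} = measure lborel ({0..1} \<inter> {..<x})"
    using U_prob[of "{..<x}" n] by simp
  also have "{0..1} \<inter> {..<x} = (if x \<le> 1 then {0..<x} else {0..1})" by auto
  also have "measure lborel \<dots> = clamp01 x"
    by (cases "0 \<le> x") (auto simp: clamp01_def)
  finally show ?thesis .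
qed

lemma U_greater: "prob {\<omega> \<in> space M. x < U n \<omega>} = clamp01 (1 - x)"
proof -
  have "prob {\<omega> \<in> space M. x < U n \<omega>} = measure lborel ({0..1} \<inter> {x<..})"
    using U_prob[of "{x<..}" n] by simp
  also have "{0..1} \<inter> {x<..} = (if 0 \<le> x then {x<..1} else {0..1})" by auto
  also have "measure lborel \<dots> = clamp01 (1 - x)"
    by (cases "x \<le> 1") (auto simp: clamp01_def)
  finally show ?thesis .
qed

lemma F_bounds: "0 \<le> F x" "F x \<le> 1" "mono F"
  using cdf_bounds[OF prob_space_distr[OF V_measurable] stream] by auto

lemma V_le: "prob {\<omega> \<in> space M. V n \<omega> \<le> x} = F x"
proof -
  have "F x = measure (distr M borel (V n)) {..x}" unfolding stream[of n, symmetric] by (simp add: cdf_def)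
  also have "\<dots> = prob {\<omega> \<in> space M. V n \<omega> \<le> x}"
    by (subst measure_distr) (auto intro!: arg_cong[where f = prob])
  finally show ?thesis ..
qed

text \<open>The intermediate value theorem applies, as \<open>F\<close> is continuous with limits 0
  and 1.\<close>

lemma F_attains:
  assumes "0 < x" "x < 1"
  obtains v where "F v = x"
proof -
  interpret D: real_distribution "distr M borel (V 0)" by (simp add: real_distribution_distr)
  have "(F \<longlongrightarrow> 0) at_bot" "(F \<longlongrightarrow> 1) at_top"
    using D.cdf_lim_at_bot D.cdf_lim_at_top_prob by (simp_all add: stream)
  then have "\<forall>\<^sub>F v in at_bot. F v < x" "\<forall>\<^sub>F v in at_top. x < F v"
    using assms by (auto dest: order_tendstoD)
  then obtain a b where ab: "F a < x" "x < F b"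
    by (auto simp: eventually_at_bot_linorder eventually_at_top_linorder)
  have "a \<le> b" using ab monoD[OF F_bounds(3), of b a] by (cases a b rule: le_cases) auto
  then obtain v where "F v = x"
    using IVT'[of F a x b] ab F continuous_on_subset[OF F] by (auto simp: less_imp_le)
  then show ?thesis by (rule that)
qed

text \<open>A point \<open>v\<close> with \<open>F v = x\<close> turns the event into one about
  \<open>V n\<close>. Since \<open>F\<close> may be constant to the right of \<open>v\<close>,
  monotonicity gives only an inclusion.\<close>

lemma FV_greater_le: "0 < x \<Longrightarrow> x < 1 \<Longrightarrow> prob {\<omega> \<in> space M. x < F (V n \<omega>)} \<le> 1 - x"
proof -
  assume "0 < x" "x < 1"
  then obtain v where v: "F v = x" by (rule F_attains)
  have "prob {\<omega> \<in> space M. x < F (V n \<omega>)} \<le> prob {\<omega> \<in> space M. \<not> V n \<omega> \<le> v}"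
    using v monoD[OF F_bounds(3)] by (intro finite_measure_mono) (auto simp: not_less[symmetric])
  also have "\<dots> = 1 - x" by (subst prob_neg) (auto simp: V_le v)
  finally show ?thesis .
qed

lemma FV_less_le: "0 < x \<Longrightarrow> x < 1 \<Longrightarrow> prob {\<omega> \<in> space M. F (V n \<omega>) < x} \<le> x"
proof -
  assume "0 < x" "x < 1"
  then obtain v where v: "F v = x" by (rule F_attains)
  have "prob {\<omega> \<in> space M. F (V n \<omega>) < x} \<le> prob {\<omega> \<in> space M. V n \<omega> \<le> v}"
  proof (intro finite_measure_mono subsetI)
    fix \<omega> assume "\<omega> \<in> {\<omega> \<in> space M. F (V n \<omega>) < x}"
    then show "\<omega> \<in> {\<omega> \<in> space M. V n \<omega> \<le> v}"
      using v monoD[OF F_bounds(3), of v "V n \<omega>"] by (cases "V n \<omega> \<le> v") auto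
  qed auto
  then show ?thesis by (simp add: V_le v)
qed

text \<open>The probability integral transform, from the two one-sided estimates.\<close>

lemma FV_less: "prob {\<omega> \<in> space M. F (V n \<omega>) < x} = clamp01 x"
proof -
  consider "x \<le> 0" | "1 < x" | "0 < x" "x \<le> 1" by linarith
  then show ?thesis
  proof cases
    case 1
    then have "\<not> F (V n \<omega>) < x" for \<omega> using F_bounds(1)[of "V n \<omega>"] by linarith
    with 1 show ?thesis by (simp add: clamp01_def)
  next
    case 2
    then have "F (V n \<omega>) < x" for \<omega> using F_bounds(2)[of "V n \<omega>"] by linarith
    with 2 show ?thesis by (simp add: clamp01_def prob_space)
  next
    case 3
    \<comment> \<open>The upper estimate on \<open>y < F (V n \<omega>)\<close> is complemented at
      levels \<open>y\<close> below \<open>x\<close>, and then \<open>y\<close> tends to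
      \<open>x\<close>.\<close>
    have "y \<le> prob {\<omega> \<in> space M. F (V n \<omega>) < x}" if y: "0 < y" "y < x" for y
    proof -
      have "y \<le> prob {\<omega> \<in> space M. \<not> y < F (V n \<omega>)}"
        using FV_greater_le[of y n] 3 y by (subst prob_neg) auto
      also have "\<dots> \<le> prob {\<omega> \<in> space M. F (V n \<omega>) < x}"
        using y by (intro finite_measure_mono) auto
      finally show ?thesis .
    qed
    then have "x \<le> prob {\<omega> \<in> space M. F (V n \<omega>) < x}"
      using 3 by (intro dense_le_bounded[of 0 x]) auto
    moreover have "prob {\<omega> \<in> space M. F (V n \<omega>) < x} \<le> x"
      using FV_less_le[of x n] 3 by (cases "x = 1") auto
    ultimately show ?thesis using 3 by (simp add: clamp01_def)
  qed
qed

text \<open>Passing to the complement requires that the level \<open>x\<close> carries no mass;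
  \<open>q\<close> is therefore squeezed between \<open>clamp01 x\<close> and
  \<open>clamp01 x + e\<close>.\<close>

lemma FV_greater: "prob {\<omega> \<in> space M. x < F (V n \<omega>)} = clamp01 (1 - x)"
proof -
  define q where "q = prob {\<omega> \<in> space M. F (V n \<omega>) \<le> x}"
  have "q \<le> clamp01 x + e" if "0 < e" for e
  proof -
    have "q \<le> prob {\<omega> \<in> space M. F (V n \<omega>) < x + e}"
      unfolding q_def using that by (intro finite_measure_mono) auto
    also have "\<dots> \<le> clamp01 x + e" using that by (auto simp: FV_less clamp01_def)
    finally show ?thesis .
  qed
  then have "q \<le> clamp01 x" by (rule field_le_epsilon)
  moreover have "clamp01 x \<le> q"
    unfolding FV_less[of n, symmetric] q_def by (intro finite_measure_mono) auto
  moreover have "prob {\<omega> \<in> space M. x < F (V n \<omega>)} = 1 - q"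
    unfolding q_def by (subst prob_neg[symmetric]) (auto simp: not_le)
  ultimately show ?thesis by (auto simp: clamp01_def max_def min_def)
qed

text \<open>With weight \<open>p\<close> the quantile is uniform on the interval of the finite
  values, which has length \<open>p\<close>, and with weight \<open>1 - p\<close> it is uniform on
  the rest, so the mixture is uniform on the unit interval. The maximum with 0 covers \<epsilon>
  above 1/2.\<close>

lemma calibrated_prob_tails:
  assumes "\<epsilon> > 0"
  shows "calibrated_prob {..<1/2 - \<epsilon>} = max 0 (1/2 - \<epsilon>)"
    and "calibrated_prob {1/2 + \<epsilon><..} = max 0 (1/2 - \<epsilon>)"
proof -
  define t u where tu: "t = 1/2 - \<epsilon>" "u = 1/2 + \<epsilon>"
  define p where "p = geom_prob w"
  have p0: "1/2 < p" "p \<le> 1" using w by (auto simp: p_def geom_prob_def field_simps)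
  consider (gt) "w > 1/2" | (lt) "w < 1/2" | (eq) "w = 1/2" by linarith
  then have "calibrated_prob {..<t} = max 0 t \<and> calibrated_prob {u<..} = max 0 t"
  proof cases
    case gt
    have p: "p = 1 / (2 * w)" "p < 1" using gt by (auto simp: p_def geom_prob_def)
    have pad: "pad_quantile w F x = p + (1 - p) * x" for x
      using gt by (simp add: pad_quantile_def quantile_def pad_value_def p)
    have val: "value_quantile w F v = p * F v" for v
      using gt by (simp add: value_quantile_def quantile_def p)
    have c: "p + (1 - p) * x < t \<longleftrightarrow> x < (t - p) / (1 - p)"
      "u < p + (1 - p) * x \<longleftrightarrow> (u - p) / (1 - p) < x"
      "p * f < t \<longleftrightarrow> f < t / p" "u < p * f \<longleftrightarrow> u / p < f" for x f
      using p0 p(2) by (auto simp: field_simps)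
    have d: "1 - (u - p) / (1 - p) = (1 - u) / (1 - p)" "1 - u / p = (p - u) / p"
      using p0 p(2) by (auto simp: field_simps)
    have "calibrated_prob {..<t} = max 0 (min (1 - p) (t - p)) + max 0 (min p t)"
      using p0 p(2)
      by (simp add: calibrated_prob_def pad_prob_def value_prob_def pad val c U_less FV_less
          mult_clamp01 flip: p_def)
    moreover have "calibrated_prob {u<..} = max 0 (min (1 - p) (1 - u)) + max 0 (min p (p - u))"
      using p0 p(2)
      by (simp add: calibrated_prob_def pad_prob_def value_prob_def pad val c U_greater FV_greater
          d mult_clamp01 flip: p_def)
    ultimately show ?thesis using p0 assms by (auto simp: tu max_def min_def split: if_splits)
  next
    case lt
    have p: "p = 1 / (2 - 2 * w)" "1 - p = (1 - 2 * w) / (2 - 2 * w)" "p < 1"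
      using lt by (auto simp: p_def geom_prob_def field_simps)
    have pad: "pad_quantile w F x = (1 - p) * x" for x
      using lt by (simp add: pad_quantile_def quantile_def pad_value_def p(2))
    have val: "value_quantile w F v = (1 - p) + p * F v" for v
      using lt by (simp add: value_quantile_def quantile_def p(2) add_divide_distrib)
        (simp add: p(1))
    have c: "(1 - p) * x < t \<longleftrightarrow> x < t / (1 - p)"
      "u < (1 - p) * x \<longleftrightarrow> u / (1 - p) < x"
      "(1 - p) + p * f < t \<longleftrightarrow> f < (t + p - 1) / p"
      "u < (1 - p) + p * f \<longleftrightarrow> (u + p - 1) / p < f" for x f
      using p0 p(3) by (auto simp: field_simps)
    have d: "1 - (u + p - 1) / p = (1 - u) / p" "1 - u / (1 - p) = (1 - p - u) / (1 - p)"
      using p0 p(3) by (auto simp: field_simps)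
    have "calibrated_prob {..<t} = max 0 (min (1 - p) t) + max 0 (min p (t + p - 1))"
      using p0 p(3)
      by (simp add: calibrated_prob_def pad_prob_def value_prob_def pad val c U_less FV_less
          mult_clamp01 flip: p_def)
    moreover have "calibrated_prob {u<..} = max 0 (min (1 - p) (1 - p - u)) + max 0 (min p (1 - u))"
      using p0 p(3)
      by (simp add: calibrated_prob_def pad_prob_def value_prob_def pad val c U_greater FV_greater
          d mult_clamp01 flip: p_def)
    ultimately show ?thesis using p0 assms by (auto simp: tu max_def min_def split: if_splits)
  next
    case eq
    then have "geom_prob w = 1" by (simp add: geom_prob_def)
    moreover have "value_quantile w F v = F v" for v
      by (simp add: eq value_quantile_def quantile_def)
    ultimately show ?thesis using assms
      by (auto simp: tu calibrated_prob_def value_prob_def FV_less FV_greater clamp01_def)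
  qed
  then show "calibrated_prob {..<1/2 - \<epsilon>} = max 0 (1/2 - \<epsilon>)"
    "calibrated_prob {1/2 + \<epsilon><..} = max 0 (1/2 - \<epsilon>)" by (auto simp: tu)
qed

section \<open>Order statistics of a block and their measurability\<close>

definition inserted :: "nat \<Rightarrow> 'a \<Rightarrow> elem" where
  "inserted i \<omega> = inserted_elem w (\<lambda>n. V n \<omega>) (\<lambda>n. Z n \<omega>) (\<lambda>n. U n \<omega>) i"

abbreviation inserted_quantile :: "nat \<Rightarrow> 'a \<Rightarrow> real" where
  "inserted_quantile \<equiv> slot_quantile 0 0 0"

lemma inserted_eq: "inserted i \<omega> =
    (case slot (G \<omega>) 0 0 i of
       None \<Rightarrow> Elem (pad_value w) (U i \<omega>) | Some m \<Rightarrow> Elem (ereal (V m \<omega>)) (U i \<omega>))"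
proof -
  have "(\<lambda>m. block_size w (Z m \<omega>)) = G \<omega>" by (simp add: G_def fun_eq_iff)
  then show ?thesis by (simp add: inserted_def inserted_elem_def)
qed

lemma quantile_inserted: "quantile w F (inserted i \<omega>) = inserted_quantile i \<omega>"
  by (auto simp: inserted_eq slot_quantile_def pad_quantile_def quantile_Elem_ereal
      split: option.split)

lemma el_tag_inserted: "el_tag (inserted i \<omega>) = U i \<omega>"
  by (auto simp: inserted_eq split: option.split)

lemma el_val_inserted_measurable [measurable]: "(\<lambda>\<omega>. el_val (inserted i \<omega>)) \<in> borel_measurable M"
proof -
  have "el_val (inserted i \<omega>)
      = (case slot (G \<omega>) 0 0 i of None \<Rightarrow> pad_value w | Some m \<Rightarrow> ereal (V m \<omega>))" for \<omega>
    by (auto simp: inserted_eq split: option.split)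
  then show ?thesis by (simp only:) (rule slot_case_measurable, measurable)
qed

lemma inserted_le_measurable [measurable]:
  "Measurable.pred M (\<lambda>\<omega>. inserted i \<omega> \<le> inserted j \<omega>)"
  "Measurable.pred M (\<lambda>\<omega>. inserted i \<omega> < inserted j \<omega>)"
  unfolding less_eq_elem_def less_elem_def el_tag_inserted by measurable

lemma pred_le_card:
  assumes "finite K" "\<And>i. i \<in> K \<Longrightarrow> Measurable.pred M (P i)"
  shows "Measurable.pred M (\<lambda>\<omega>. m \<le> card {i \<in> K. P i \<omega>})"
  unfolding le_card_filter_iff[OF assms(1)]
  using assms by (intro pred_intros_finite pred_intros_logic) (auto intro: finite_subset)

definition block_nth :: "nat \<Rightarrow> nat \<Rightarrow> nat \<Rightarrow> 'a \<Rightarrow> elem" where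
  "block_nth a r m \<omega> = nth_smallest (mset (map (\<lambda>i. inserted i \<omega>) [a..<a + r])) m"

lemma block_nth_iff:
  assumes "0 < m" "m \<le> r"
    and "\<And>i j. i \<in> {a..<a + r} \<Longrightarrow> j \<in> {a..<a + r} \<Longrightarrow> inserted i \<omega> \<le> inserted j \<omega>
      \<Longrightarrow> P (inserted j \<omega>) \<Longrightarrow> P (inserted i \<omega>)"
  shows "P (block_nth a r m \<omega>) \<longleftrightarrow> m \<le> card {i \<in> {a..<a + r}. P (inserted i \<omega>)}"
proof -
  have "P (block_nth a r m \<omega>)
      \<longleftrightarrow> m \<le> size (filter_mset P (mset (map (\<lambda>i. inserted i \<omega>) [a..<a + r])))"
    unfolding block_nth_def
  proof (rule nth_smallest_iff)
    fix x y assume "x \<in># mset (map (\<lambda>i. inserted i \<omega>) [a..<a + r])"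
      "y \<in># mset (map (\<lambda>i. inserted i \<omega>) [a..<a + r])" "x \<le> y" "P y"
    then show "P x" using assms(3) by auto
  qed (use assms in auto)
  then show ?thesis by (simp only: size_filter_mset_map_upt)
qed

text \<open>Measurability is reached without a sigma-algebra on \<open>elem\<close>: the
  \<open>m\<close>-th smallest element is found among the inserted ones as the one with at least
  \<open>m\<close> elements up to it and fewer than \<open>m\<close> strictly below, and both are
  counting conditions.\<close>

lemma block_nth_quantile_iff:
  assumes m: "0 < m" "m \<le> r"
  shows "quantile w F (block_nth a r m \<omega>) \<in> S \<longleftrightarrow>
    (\<exists>i\<in>{a..<a + r}. (m \<le> card {j \<in> {a..<a + r}. inserted j \<omega> \<le> inserted i \<omega>}
         \<and> \<not> m \<le> card {j \<in> {a..<a + r}. inserted j \<omega> < inserted i \<omega>})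
       \<and> inserted_quantile i \<omega> \<in> S)"
proof -
  have mid: "m \<le> card {j \<in> {a..<a + r}. inserted j \<omega> \<le> y}
       \<and> \<not> m \<le> card {j \<in> {a..<a + r}. inserted j \<omega> < y} \<longleftrightarrow> block_nth a r m \<omega> = y" for y
  proof -
    have le: "block_nth a r m \<omega> \<le> y \<longleftrightarrow> m \<le> card {j \<in> {a..<a + r}. inserted j \<omega> \<le> y}"
      by (rule block_nth_iff[OF m]) (rule order_trans)
    have lt: "block_nth a r m \<omega> < y \<longleftrightarrow> m \<le> card {j \<in> {a..<a + r}. inserted j \<omega> < y}"
      by (rule block_nth_iff[OF m]) (rule le_less_trans)
    show ?thesis unfolding le[symmetric] lt[symmetric] by auto
  qed
  have "\<exists>i\<in>{a..<a + r}. block_nth a r m \<omega> = inserted i \<omega>"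
    using nth_smallest_in[of m "mset (map (\<lambda>i. inserted i \<omega>) [a..<a + r])"] m
    by (auto simp: block_nth_def)
  then show ?thesis unfolding mid quantile_inserted[symmetric] by auto
qed

lemma block_nth_quantile_measurable:
  assumes m: "0 < m" "m \<le> r"
  shows "(\<lambda>\<omega>. quantile w F (block_nth a r m \<omega>)) \<in> borel_measurable M"
proof (rule measurableI)
  fix S :: "real set" assume [measurable]: "S \<in> sets borel"
  have "Measurable.pred M (\<lambda>\<omega>. quantile w F (block_nth a r m \<omega>) \<in> S)"
    unfolding block_nth_quantile_iff[OF m]
    by (intro pred_intros_finite pred_intros_logic pred_le_card) auto
  then show "(\<lambda>\<omega>. quantile w F (block_nth a r m \<omega>)) -` S \<inter> space M \<in> sets M"
    by (simp add: pred_def vimage_def Int_def conj_commute)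
qed simp

section \<open>Joint law of the coin and the counts in a block\<close>

lemma prob_coin: "prob {\<omega> \<in> space M. B k \<omega> = b} = 1/2"
proof -
  have "prob {\<omega> \<in> space M. B k \<omega> = b} = measure (distr M (count_space UNIV) (B k)) {b}"
    by (subst measure_distr) (auto intro!: arg_cong[where f = prob])
  also have "\<dots> = 1/2" unfolding coins by (cases b) (simp_all add: measure_pmf_single)
  finally show ?thesis .
qed

text \<open>The coin is placed among the constrained sources from the start, which yields the factor
  1/2. Positions before the block are constrained by \<open>UNIV\<close> and contribute factors
  1.\<close>

lemma prob_block_pattern:
  assumes S [measurable]: "S \<in> sets borel" and J: "J \<subseteq> {a..<a + r}"
  shows "prob {\<omega> \<in> space M. B k \<omega> = b \<and> {i \<in> {a..<a + r}. inserted_quantile i \<omega> \<in> S} = J}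
    = 1/2 * (calibrated_prob S ^ card J * (1 - calibrated_prob S) ^ (r - card J))"
proof -
  let ?K = "{a..<a + r}"
  define A where "A i = (if i \<in> J then S else if i \<in> ?K then - S else UNIV)" for i
  have "x \<in> A i \<longleftrightarrow> (i \<in> ?K \<longrightarrow> (x \<in> S \<longleftrightarrow> i \<in> J))" for x i
    using J by (cases "i \<in> J"; cases "i \<in> ?K") (auto simp: A_def)
  then have "(\<forall>i<a + r. inserted_quantile i \<omega> \<in> A i)
      \<longleftrightarrow> (\<forall>i\<in>?K. inserted_quantile i \<omega> \<in> S \<longleftrightarrow> i \<in> J)" for \<omega>
    by auto
  moreover have "(\<forall>i\<in>?K. inserted_quantile i \<omega> \<in> S \<longleftrightarrow> i \<in> J)
      \<longleftrightarrow> {i \<in> ?K. inserted_quantile i \<omega> \<in> S} = J" for \<omega>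
    using J by blast
  ultimately have "(\<forall>i<a + r. inserted_quantile i \<omega> \<in> A i)
      \<longleftrightarrow> {i \<in> ?K. inserted_quantile i \<omega> \<in> S} = J" for \<omega>
    by blast
  then have "{\<omega> \<in> space M. B k \<omega> = b \<and> {i \<in> ?K. inserted_quantile i \<omega> \<in> S} = J}
      = source_event {Coin k} (\<lambda>_. {of_bool b}) 0 0 0 (a + r) A"
    by (simp add: source_event_def G_pos)
  also have "prob \<dots> = prob {\<omega> \<in> space M. X (Coin k) \<omega> \<in> {of_bool b}}
      * (\<Prod>i<a + r. calibrated_prob (A i))"
    by (subst prob_source_event) (auto simp: A_def)
  also have "(\<Prod>i<a + r. calibrated_prob (A i)) = (\<Prod>i\<in>?K. calibrated_prob (A i))"
    using J by (intro prod.mono_neutral_right) (auto simp: A_def calibrated_prob_UNIV)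
  also have "\<dots> = (\<Prod>i\<in>?K - J. calibrated_prob (A i)) * (\<Prod>i\<in>J. calibrated_prob (A i))"
    by (rule prod.subset_diff[OF J]) simp
  also have "(\<Prod>i\<in>J. calibrated_prob (A i)) = calibrated_prob S ^ card J"
    by (simp add: A_def)
  also have "(\<Prod>i\<in>?K - J. calibrated_prob (A i)) = (1 - calibrated_prob S) ^ (r - card J)"
    using card_Diff_subset[OF finite_subset[OF J] J] by (simp add: A_def calibrated_prob_Compl)
  also have "{\<omega> \<in> space M. X (Coin k) \<omega> \<in> {of_bool b}} = {\<omega> \<in> space M. B k \<omega> = b}"
    by (auto simp: of_bool_eq_iff)
  finally show ?thesis by (simp only: prob_coin) simp
qed

lemma prob_block_count:
  assumes S [measurable]: "S \<in> sets borel"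
  shows "prob {\<omega> \<in> space M. B k \<omega> = b \<and> m \<le> card {i \<in> {a..<a + r}. inserted_quantile i \<omega> \<in> S}}
    = 1/2 * binomial_tail {a..<a + r} (calibrated_prob S) m"
proof -
  let ?K = "{a..<a + r}"
  let ?E = "\<lambda>J. {\<omega> \<in> space M. B k \<omega> = b \<and> {i \<in> ?K. inserted_quantile i \<omega> \<in> S} = J}"
  let ?\<J> = "{J. J \<subseteq> ?K \<and> m \<le> card J}"
  have "?E J \<in> sets M" for J
  proof -
    have "?E J = {\<omega> \<in> space M. B k \<omega> = b \<and> J \<subseteq> ?K \<and> (\<forall>i\<in>?K. inserted_quantile i \<omega> \<in> S \<longleftrightarrow> i \<in> J)}"
      by auto
    also have "\<dots> \<in> sets M" by measurable
    finally show ?thesis .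
  qed
  then have "prob (\<Union>J\<in>?\<J>. ?E J) = (\<Sum>J\<in>?\<J>. prob (?E J))"
    by (intro finite_measure_finite_Union) (auto simp: disjoint_family_on_def)
  also have "\<dots> = (\<Sum>J\<in>?\<J>. 1/2 * (calibrated_prob S ^ card J * (1 - calibrated_prob S) ^ (r - card J)))"
    by (intro sum.cong refl prob_block_pattern) auto
  also have "\<dots> = 1/2 * binomial_tail ?K (calibrated_prob S) m"
    unfolding binomial_tail_def sum_distrib_left[symmetric] by simp
  also have "(\<Union>J\<in>?\<J>. ?E J)
      = {\<omega> \<in> space M. B k \<omega> = b \<and> m \<le> card {i \<in> ?K. inserted_quantile i \<omega> \<in> S}}"
    by auto
  finally show ?thesis .
qed

section \<open>Tail probabilities of the order statistics\<close>

lemma AE_tags: "AE \<omega> in M. \<forall>i. 0 \<le> U i \<omega> \<and> U i \<omega> \<le> 1"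
proof -
  have "AE \<omega> in M. U i \<omega> \<in> {0..1}" for i
    using U_prob[of "{0..1}" i] by (subst prob_Collect_eq_1[symmetric]) auto
  then show ?thesis by (simp add: AE_all_countable)
qed

lemma block_nth_threshold:
  assumes m: "0 < m" "m \<le> r" and tags: "\<forall>i. 0 \<le> U i \<omega> \<and> U i \<omega> \<le> 1"
  shows "quantile w F (block_nth a r m \<omega>) < t
      \<longleftrightarrow> m \<le> card {i \<in> {a..<a + r}. inserted_quantile i \<omega> \<in> {..<t}}"
    and "u < quantile w F (block_nth a r m \<omega>)
      \<longleftrightarrow> r - m + 1 \<le> card {i \<in> {a..<a + r}. inserted_quantile i \<omega> \<in> {u<..}}"
proof -
  have mono: "quantile w F (inserted i \<omega>) \<le> quantile w F (inserted j \<omega>)"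
    if "inserted i \<omega> \<le> inserted j \<omega>" for i j
    using tags that by (intro quantile_mono[OF w F_bounds(3,1,2)]) (auto simp: el_tag_inserted)
  show "quantile w F (block_nth a r m \<omega>) < t
      \<longleftrightarrow> m \<le> card {i \<in> {a..<a + r}. inserted_quantile i \<omega> \<in> {..<t}}"
    using block_nth_iff[OF m, of a \<omega> "\<lambda>x. quantile w F x < t"] mono
    by (auto simp: quantile_inserted intro: le_less_trans)
  \<comment> \<open>Only the negation is closed downwards. The order statistic is at most
    \<open>u\<close> iff at most \<open>r - m\<close> quantiles exceed \<open>u\<close>, whence
    \<open>r - m + 1\<close> for the opposite.\<close>
  have "\<not> u < quantile w F (block_nth a r m \<omega>)
      \<longleftrightarrow> m \<le> card {i \<in> {a..<a + r}. \<not> u < inserted_quantile i \<omega>}"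
    using block_nth_iff[OF m, of a \<omega> "\<lambda>x. \<not> u < quantile w F x"] mono
    by (auto simp: quantile_inserted not_less intro: order_trans)
  moreover have "card {i \<in> {a..<a + r}. \<not> u < inserted_quantile i \<omega>}
      = r - card {i \<in> {a..<a + r}. u < inserted_quantile i \<omega>}"
    by (subst card_Diff_subset[symmetric, of _ "{a..<a + r}", simplified])
      (auto intro!: arg_cong[where f = card])
  ultimately show "u < quantile w F (block_nth a r m \<omega>)
      \<longleftrightarrow> r - m + 1 \<le> card {i \<in> {a..<a + r}. inserted_quantile i \<omega> \<in> {u<..}}"
    using m by auto
qed

lemma prob_block_nth:
  assumes m: "0 < m" "m \<le> r"
  shows "prob {\<omega> \<in> space M. B k \<omega> = b \<and> quantile w F (block_nth a r m \<omega>) < t}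
      = 1/2 * binomial_tail {a..<a + r} (calibrated_prob {..<t}) m"
    and "prob {\<omega> \<in> space M. B k \<omega> = b \<and> u < quantile w F (block_nth a r m \<omega>)}
      = 1/2 * binomial_tail {a..<a + r} (calibrated_prob {u<..}) (r - m + 1)"
proof -
  note [measurable] = block_nth_quantile_measurable[OF m]
  have [measurable]: "Measurable.pred M (\<lambda>\<omega>. j \<le> card {i \<in> {a..<a + r}. inserted_quantile i \<omega> \<in> S})"
    if [measurable]: "S \<in> sets borel" for S j by (rule pred_le_card) auto
  show "prob {\<omega> \<in> space M. B k \<omega> = b \<and> quantile w F (block_nth a r m \<omega>) < t}
      = 1/2 * binomial_tail {a..<a + r} (calibrated_prob {..<t}) m"
    \<comment> \<open>The events agree only where all tags lie in the unit interval, hence almost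
      everywhere.\<close>
    by (subst prob_block_count[of _ k b, symmetric, OF borel_open], simp,
        rule finite_measure_eq_AE, rule AE_mp[OF AE_tags])
      (auto simp: block_nth_threshold(1)[OF m])
  show "prob {\<omega> \<in> space M. B k \<omega> = b \<and> u < quantile w F (block_nth a r m \<omega>)}
      = 1/2 * binomial_tail {a..<a + r} (calibrated_prob {u<..}) (r - m + 1)"
    by (subst prob_block_count[of _ k b, symmetric, OF borel_open], simp,
        rule finite_measure_eq_AE, rule AE_mp[OF AE_tags])
      (auto simp: block_nth_threshold(2)[OF m])
qed

lemma sent_pair_block_nth:
  assumes "r > 0"
  shows "sent_pair r s w (\<lambda>n. V n \<omega>) (\<lambda>n. Z n \<omega>) (\<lambda>n. U n \<omega>) k
    = (block_nth (k * r) r (r div 2) \<omega>, block_nth (k * r) r (r div 2 + 1) \<omega>)"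
  by (simp add: sent_pair_eq[OF assms] middle_pair_def block_nth_def inserted_def[abs_def])

lemma prob_coin_split:
  assumes [measurable]: "Measurable.pred M P" "Measurable.pred M Q"
  shows "prob {\<omega> \<in> space M. if B k \<omega> then P \<omega> else Q \<omega>}
    = prob {\<omega> \<in> space M. B k \<omega> = True \<and> P \<omega>} + prob {\<omega> \<in> space M. B k \<omega> = False \<and> Q \<omega>}"
  by (subst finite_measure_Union[symmetric]) (auto intro!: arg_cong[where f = prob])

end

section \<open>The two tails of the sent elements\<close>

theorem theorem3:
  fixes M :: "'a measure"
    and V :: "nat \<Rightarrow> 'a \<Rightarrow> real" and Z :: "nat \<Rightarrow> 'a \<Rightarrow> nat"
    and U :: "nat \<Rightarrow> 'a \<Rightarrow> real" and B :: "nat \<Rightarrow> 'a \<Rightarrow> bool"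
    and F :: "real \<Rightarrow> real" and w \<epsilon> :: real and r s k :: nat
    and v' v'' v :: "'a \<Rightarrow> elem"
  assumes w: "0 < w" "w < 1"
    and r: "even r" "r > 0"
    and s: "even s" "s > 0"
    and M: "prob_space M"
    and indep: "prob_space.indep_vars M (\<lambda>_. borel) (source_rv V Z U B) UNIV"
    and stream: "\<And>n. cdf (distr M borel (V n)) = F"
    and F: "continuous_on UNIV F"
    and geom: "\<And>n. distr M (count_space UNIV) (Z n)
                     = measure_pmf (map_pmf Suc (geometric_pmf (geom_prob w)))"
    and tags: "\<And>n. distr M borel (U n) = uniform_measure lborel {0..1}"
    and coins: "\<And>n. distr M (count_space UNIV) (B n) = measure_pmf (bernoulli_pmf (1/2))"
    and \<epsilon>: "\<epsilon> > 0"
  defines "v' \<equiv> \<lambda>\<omega>. fst (sent_pair r s w (\<lambda>n. V n \<omega>) (\<lambda>n. Z n \<omega>) (\<lambda>n. U n \<omega>) k)"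
    and "v'' \<equiv> \<lambda>\<omega>. snd (sent_pair r s w (\<lambda>n. V n \<omega>) (\<lambda>n. Z n \<omega>) (\<lambda>n. U n \<omega>) k)"
    and "v \<equiv> \<lambda>\<omega>. if B k \<omega> then v' \<omega> else v'' \<omega>"
  shows "measure M {\<omega> \<in> space M. quantile w F (v \<omega>) - 1/2 < - \<epsilon>}
           = measure M {\<omega> \<in> space M. quantile w F (v \<omega>) - 1/2 > \<epsilon>}
         \<and> measure M {\<omega> \<in> space M. quantile w F (v \<omega>) - 1/2 > \<epsilon>} \<le> exp (- (\<epsilon>\<^sup>2 * real r))
         \<and> (\<forall>x \<in> {v', v''}.
              measure M {\<omega> \<in> space M. quantile w F (x \<omega>) - 1/2 < - \<epsilon>} \<le> exp (- (\<epsilon>\<^sup>2 * real r))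
            \<and> measure M {\<omega> \<in> space M. quantile w F (x \<omega>) - 1/2 > \<epsilon>} \<le> exp (- (\<epsilon>\<^sup>2 * real r)))"
proof -
  interpret calibrated_stream M V Z U B F w
    by (intro calibrated_stream.intro calibrated_stream_axioms.intro) (fact assms)+
  obtain h where h: "r = 2 * h" using r(1) by (auto elim: evenE)
  have h0: "0 < h" using r(2) h by simp
  define a where "a = k * r"
  define T where "T = binomial_tail {a..<a + r} (max 0 (1/2 - \<epsilon>))"
  have T: "T m \<le> exp (- (\<epsilon>\<^sup>2 * real r))" if "h \<le> m" for m
    using binomial_tail_le_exp[OF \<epsilon> that, of "{a..<a + r}"] h h0 by (simp add: T_def)
  have v: "v' = block_nth a r h" "v'' = block_nth a r (h + 1)"
    unfolding v'_def v''_def sent_pair_block_nth[OF r(2)] a_def using h by simp_all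
  have m: "0 < h" "h \<le> r" "0 < h + 1" "h + 1 \<le> r" using h h0 by auto
  \<comment> \<open>With \<open>r = 2 * h\<close>, the count \<open>r - m + 1\<close> is
    \<open>h + 1\<close> for \<open>m = h\<close> and \<open>h\<close> for \<open>m = h + 1\<close>:
    the two middle elements have each other's tails.\<close>
  have lh: "prob {\<omega> \<in> space M. B k \<omega> = b \<and> quantile w F (v' \<omega>) < 1/2 - \<epsilon>} = 1/2 * T h"
    and gh: "prob {\<omega> \<in> space M. B k \<omega> = b \<and> 1/2 + \<epsilon> < quantile w F (v' \<omega>)} = 1/2 * T (h + 1)"
    and lh1: "prob {\<omega> \<in> space M. B k \<omega> = b \<and> quantile w F (v'' \<omega>) < 1/2 - \<epsilon>} = 1/2 * T (h + 1)"
    and gh1: "prob {\<omega> \<in> space M. B k \<omega> = b \<and> 1/2 + \<epsilon> < quantile w F (v'' \<omega>)} = 1/2 * T h" for b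
    unfolding v prob_block_nth[OF m(1,2)] prob_block_nth[OF m(3,4)] calibrated_prob_tails[OF \<epsilon>]
    using h h0 by (simp_all add: T_def)
  have [measurable]: "(\<lambda>\<omega>. quantile w F (v' \<omega>)) \<in> borel_measurable M"
    "(\<lambda>\<omega>. quantile w F (v'' \<omega>)) \<in> borel_measurable M"
    unfolding v by (rule block_nth_quantile_measurable[OF m(1,2)] block_nth_quantile_measurable[OF m(3,4)])+
  have less: "x - 1/2 < - \<epsilon> \<longleftrightarrow> x < 1/2 - \<epsilon>" and greater: "x - 1/2 > \<epsilon> \<longleftrightarrow> 1/2 + \<epsilon> < x" for x :: real
    by auto
  have q: "quantile w F (v \<omega>) < y \<longleftrightarrow> (if B k \<omega> then quantile w F (v' \<omega>) < y else quantile w F (v'' \<omega>) < y)"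
    "y < quantile w F (v \<omega>) \<longleftrightarrow> (if B k \<omega> then y < quantile w F (v' \<omega>) else y < quantile w F (v'' \<omega>))" for \<omega> y
    by (auto simp: v_def)
  \<comment> \<open>The fair coin averages \<open>T h\<close> and \<open>T (h + 1)\<close> on either
    side, in opposite order, which gives the equality.\<close>
  have "prob {\<omega> \<in> space M. quantile w F (v \<omega>) < 1/2 - \<epsilon>} = 1/2 * T h + 1/2 * T (h + 1)"
    unfolding q by (subst prob_coin_split) (measurable, simp only: lh lh1)
  moreover have "prob {\<omega> \<in> space M. 1/2 + \<epsilon> < quantile w F (v \<omega>)} = 1/2 * T (h + 1) + 1/2 * T h"
    unfolding q by (subst prob_coin_split) (measurable, simp only: gh gh1)
  \<comment> \<open>Splitting along the coin with the same predicate in both branches sums the coin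
    out.\<close>
  moreover have "prob {\<omega> \<in> space M. quantile w F (v' \<omega>) < 1/2 - \<epsilon>} = T h"
    using prob_coin_split[of "\<lambda>\<omega>. quantile w F (v' \<omega>) < 1/2 - \<epsilon>" "\<lambda>\<omega>. quantile w F (v' \<omega>) < 1/2 - \<epsilon>" k]
    unfolding lh by simp
  moreover have "prob {\<omega> \<in> space M. 1/2 + \<epsilon> < quantile w F (v' \<omega>)} = T (h + 1)"
    using prob_coin_split[of "\<lambda>\<omega>. 1/2 + \<epsilon> < quantile w F (v' \<omega>)" "\<lambda>\<omega>. 1/2 + \<epsilon> < quantile w F (v' \<omega>)" k]
    unfolding gh by simp
  moreover have "prob {\<omega> \<in> space M. quantile w F (v'' \<omega>) < 1/2 - \<epsilon>} = T (h + 1)"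
    using prob_coin_split[of "\<lambda>\<omega>. quantile w F (v'' \<omega>) < 1/2 - \<epsilon>" "\<lambda>\<omega>. quantile w F (v'' \<omega>) < 1/2 - \<epsilon>" k]
    unfolding lh1 by simp
  moreover have "prob {\<omega> \<in> space M. 1/2 + \<epsilon> < quantile w F (v'' \<omega>)} = T h"
    using prob_coin_split[of "\<lambda>\<omega>. 1/2 + \<epsilon> < quantile w F (v'' \<omega>)" "\<lambda>\<omega>. 1/2 + \<epsilon> < quantile w F (v'' \<omega>)" k]
    unfolding gh1 by simp
  ultimately show ?thesis
    unfolding less greater using T[of h] T[of "h + 1"] by auto
qed

end
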